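(* Let $p,q\in(1,\infty)$. The simple $A_{p,q}$-condition is sufficient for the two weight Stein's inequality, i.e. for all Radon measures $\sigma,w$ on $\mathbb{R}^N$ with $(\sigma,w)_{p,q}<\infty$ there is a finite constant $\mathscr{S}$ such that $$\Big\|\Big(\sum_{Q\in\mathscr{D}}\Big(\frac{\int_Qf_Q\,d\sigma}{|Q|}\Big)^21_Q\Big)^{1/2}\Big\|_{L^q(w)}\le\mathscr{S}\Big\|\Big(\sum_{Q\in\mathscr{D}}f_Q^21_Q\Big)^{1/2}\Big\|_{L^p(\sigma)}$$ for every collection $\{f_Q\}_{Q\in\mathscr{D}}$ of locally $\sigma$-integrable functions, if and only if $1<p\le2\le q<\infty$.
   Context: All functions are real valued. A dyadic lattice $\mathscr{D}=\bigcup_{k\in\mathbb{Z}}\mathscr{D}_k$ on $\mathbb{R}^N$ is fixed: each $\mathscr{D}_k$ is a disjoint cover of $\mathbb{R}^N$ by cubes of the form $x+[0,2^{-k})^N$, and every cube in $\mathscr{D}_k$ is a union of $2^N$ cubes of $\mathscr{D}_{k+1}$. $|Q|$ is the Lebesgue measure of $Q$, and $p'$ is the Hölder conjugate of $p$. The simple $A_{p,q}$-condition is $$(\sigma,w)_{p,q}:=\sup_{Q\in\mathscr{D}}\frac{\sigma(Q)^{1/p'}w(Q)^{1/q}}{|Q|}<\infty.$$ *)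

theory Defs
  imports "HOL-Analysis.Analysis"
begin

text \<open>The exponent is meant to be positive; then \<open>0\<close> is mapped to \<open>0\<close> and \<open>\<infinity>\<close> to \<open>\<infinity>\<close>.\<close>

definition ennreal_powr :: "ennreal \<Rightarrow> real \<Rightarrow> ennreal" where
  "ennreal_powr x a = (if x = \<infinity> then \<infinity> else ennreal (enn2real x powr a))"

definition hoelder_conjugate :: "real \<Rightarrow> real" where
  "hoelder_conjugate p = p / (p - 1)"

definition half_open_cube :: "real ^ 'n \<Rightarrow> real \<Rightarrow> (real ^ 'n) set" where
  "half_open_cube x l = {y. \<forall>i. x $ i \<le> y $ i \<and> y $ i < x $ i + l}"

text \<open>A lattice is represented by the set of all its cubes. The generation of a cube is
  determined by its side length, so nothing is lost by forgetting the index.\<close>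

definition dyadic_lattice :: "(real ^ 'n) set set \<Rightarrow> bool" where
  "dyadic_lattice \<D> \<longleftrightarrow>
     (\<exists>G :: int \<Rightarrow> (real ^ 'n) set set.
        \<D> = (\<Union>k. G k) \<and>
        (\<forall>k. partition_on UNIV (G k)) \<and>
        (\<forall>k. \<forall>Q\<in>G k. \<exists>x. Q = half_open_cube x (2 powi (- k))) \<and>
        (\<forall>k. \<forall>Q\<in>G k. \<exists>C\<subseteq>G (k + 1). card C = 2 ^ CARD('n) \<and> Q = \<Union>C))"

definition radon_measure :: "'a :: topological_space measure \<Rightarrow> bool" where
  "radon_measure M \<longleftrightarrow>
     sets M = sets borel \<and>
     (\<forall>K. compact K \<longrightarrow> emeasure M K < \<infinity>) \<and>
     (\<forall>B\<in>sets borel. emeasure M B = (SUP K\<in>{K. K \<subseteq> B \<and> compact K}. emeasure M K))"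

definition locally_integrable :: "'a :: topological_space measure \<Rightarrow> ('a \<Rightarrow> real) \<Rightarrow> bool" where
  "locally_integrable M f \<longleftrightarrow> (\<forall>K. compact K \<longrightarrow> set_integrable M K f)"

definition Lp_norm :: "real \<Rightarrow> 'a measure \<Rightarrow> ('a \<Rightarrow> ennreal) \<Rightarrow> ennreal" where
  "Lp_norm p M g = ennreal_powr (\<integral>\<^sup>+ x. ennreal_powr (g x) p \<partial>M) (1 / p)"

text \<open>The square function is \<open>\<infinity>\<close> wherever the sum diverges.\<close>

definition square_function ::
    "(real ^ 'n) set set \<Rightarrow> ((real ^ 'n) set \<Rightarrow> real ^ 'n \<Rightarrow> real) \<Rightarrow> real ^ 'n \<Rightarrow> ennreal" where
  "square_function \<D> g x =
     ennreal_powr (\<Sum>\<^sub>\<infinity>Q\<in>\<D>. ennreal ((g Q x)\<^sup>2) * indicator Q x) (1 / 2)"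

definition simple_A ::
    "(real ^ 'n) set set \<Rightarrow> real \<Rightarrow> real \<Rightarrow> (real ^ 'n) measure \<Rightarrow> (real ^ 'n) measure \<Rightarrow> ennreal" where
  "simple_A \<D> p q \<sigma> w =
     (SUP Q\<in>\<D>. ennreal_powr (emeasure \<sigma> Q) (1 / hoelder_conjugate p)
                 * ennreal_powr (emeasure w Q) (1 / q) / emeasure lborel Q)"

end

theory Submission
  imports Defs "HOL-Probability.Giry_Monad"
begin

text \<open>
  Write \<open>c Q\<close> for the average of \<open>f Q\<close> over a cube and \<open>b Q\<close> for the \<open>p\<close>-th power integral of
  \<open>f Q\<close> over it with respect to \<open>\<sigma>\<close>.

  If \<open>p \<le> 2 \<le> q\<close>, the inequality holds with the \<open>A\<close>-constant itself. As \<open>q / 2 \<ge> 1\<close>,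
  Minkowski's inequality in \<open>L^(q/2)(w)\<close> (\<open>nn_integral_Minkowski\<close>) bounds the square of the left-hand side by the sum of the \<open>(c Q)\<^sup>2 * w(Q) powr (2 / q)\<close>. By
  Hoelder's inequality each summand is at most the square of the \<open>A\<close>-constant times
  \<open>b Q powr (2 / p)\<close>. As \<open>2 / p \<ge> 1\<close>, the sum of the \<open>b Q powr (2 / p)\<close> is at most the square of
  the right-hand norm; this is Minkowski's inequality again, with the roles of sum and integral
  exchanged (\<open>nn_integral_reverse_Minkowski_sum\<close>). The three steps are assembled in
  \<open>averages_square_function_le\<close>.

  For the converse, fix a point \<open>x\<close> and let \<open>L 0, L 1, \<dots>\<close> be the shrinking cubes that contain it.
  One of the weights is the point mass at \<open>x\<close>, so that only cubes containing \<open>x\<close> matter for the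
  \<open>A\<close>-condition. The other one, \<open>\<mu>\<close>, puts an atom of mass \<open>\<bar>L n\<bar> powr s\<close> at a point \<open>y n\<close> of
  \<open>L n\<close> outside \<open>L (n + 1)\<close> (\<open>chain_atomic_measure\<close>). The masses decay geometrically, hence
  \<open>\<mu>(L n)\<close> is comparable to \<open>\<bar>L n\<bar> powr s\<close>, and the \<open>A\<close>-condition holds when \<open>s = p'\<close> and \<open>\<sigma> = \<mu>\<close>,
  or when \<open>s = q\<close> and \<open>w = \<mu>\<close>. In the first case, functions \<open>f (L n)\<close> supported on the single
  atoms \<open>y n\<close> turn Stein's inequality into a bound of an \<open>\<ell>\<^sup>2\<close> norm by an \<open>\<ell>\<^sup>p\<close> norm, which is false
  for \<open>p > 2\<close>. In the second case, constant functions \<open>f (L n)\<close> turn it into a bound of an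
  \<open>\<ell>\<^sup>q\<close> norm by an \<open>\<ell>\<^sup>2\<close> norm, which is false for \<open>q < 2\<close>.
\<close>

section \<open>Real powers of extended nonnegative reals\<close>

lemma ennreal_powr_0 [simp]: "ennreal_powr 0 a = 0"
  by (simp add: ennreal_powr_def)

lemma ennreal_powr_top [simp]: "ennreal_powr top a = top"
  by (simp add: ennreal_powr_def)

lemma ennreal_powr_ennreal [simp]:
  "0 \<le> x \<Longrightarrow> ennreal_powr (ennreal x) a = ennreal (x powr a)"
  by (simp add: ennreal_powr_def)

lemma ennreal_powr_1 [simp]: "ennreal_powr x 1 = x"
  by (cases x) auto

lemma ennreal_powr_eq_0_iff [simp]: "ennreal_powr x a = 0 \<longleftrightarrow> x = 0"
  by (cases x) (auto simp: ennreal_eq_0_iff)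

lemma ennreal_powr_two: "ennreal_powr x 2 = x\<^sup>2"
  by (cases x) (auto simp: ennreal_power)

lemma ennreal_powr_mono: "x \<le> y \<Longrightarrow> 0 \<le> a \<Longrightarrow> ennreal_powr x a \<le> ennreal_powr y a"
  by (cases x; cases y) (auto intro!: ennreal_leI powr_mono2 simp: top_unique)

lemma ennreal_powr_mult: "ennreal_powr (x * y) a = ennreal_powr x a * ennreal_powr y a"
proof (cases "x = 0 \<or> y = 0")
  case False
  then show ?thesis
    by (cases x; cases y) (auto simp: powr_mult ennreal_mult_top ennreal_top_mult
        simp flip: ennreal_mult)
qed auto

lemma ennreal_powr_powr: "ennreal_powr (ennreal_powr x a) b = ennreal_powr x (a * b)"
  by (cases x) (auto simp: powr_powr)

text \<open>Raising to \<open>r\<close> and to \<open>1 / r\<close> are adjoint monotone maps. This makes powers commute with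
  suprema, and it moves exponents across inequalities.\<close>

lemma ennreal_powr_le_iff:
  assumes "0 < r"
  shows "ennreal_powr x r \<le> y \<longleftrightarrow> x \<le> ennreal_powr y (1 / r)"
  using ennreal_powr_mono[of "ennreal_powr x r" y "1 / r"]
    ennreal_powr_mono[of x "ennreal_powr y (1 / r)" r] assms
  by (auto simp: ennreal_powr_powr)

lemma ennreal_powr_SUP:
  assumes "0 < r"
  shows "ennreal_powr (SUP i\<in>I. f i) r = (SUP i\<in>I. ennreal_powr (f i) r)"
proof (rule antisym)
  show "ennreal_powr (SUP i\<in>I. f i) r \<le> (SUP i\<in>I. ennreal_powr (f i) r)"
    unfolding ennreal_powr_le_iff[OF assms]
    by (intro SUP_least) (auto simp flip: ennreal_powr_le_iff[OF assms] intro: SUP_upper)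
  show "(SUP i\<in>I. ennreal_powr (f i) r) \<le> ennreal_powr (SUP i\<in>I. f i) r"
    using assms by (intro SUP_least ennreal_powr_mono SUP_upper) auto
qed

lemma borel_measurable_ennreal_powr [measurable (raw)]:
  assumes [measurable]: "f \<in> borel_measurable M"
  shows "(\<lambda>x. ennreal_powr (f x) a) \<in> borel_measurable M"
  unfolding ennreal_powr_def infinity_ennreal_def by measurable

text \<open>The integrands vanish at many points, so convexity is needed with the endpoint \<open>0\<close>
  included.\<close>

lemma convex_on_powr_nonneg:
  fixes r :: real
  assumes "1 \<le> r"
  shows "convex_on {0..} (\<lambda>x::real. x powr r)"
proof (rule convex_onI)
  fix t x y :: real
  assume t: "0 < t" "t < 1" and xy: "x \<in> {0..}" "y \<in> {0..}"
  have *: "s powr r \<le> s" if "0 < s" "s < 1" for s :: real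
    using powr_mono'[of 1 r s] assms that by simp
  consider "x = 0" | "y = 0" | "0 < x" "0 < y" using xy by force
  then show "((1 - t) *\<^sub>R x + t *\<^sub>R y) powr r \<le> (1 - t) * x powr r + t * y powr r"
  proof cases
    case 1
    then show ?thesis using *[of t] t xy assms by (auto simp: powr_mult intro: mult_right_mono)
  next
    case 2
    then show ?thesis using *[of "1 - t"] t xy assms by (auto simp: powr_mult intro: mult_right_mono)
  next
    case 3
    then show ?thesis
      using convex_onD[OF powr_convex[OF assms], of t x y] t by simp
  qed
qed (simp add: convex_real_interval)

text \<open>Both Minkowski inequalities below come from this form of Jensen's inequality: normalising
  each term by its own norm turns the sum into a convex combination.\<close>

lemma ennreal_powr_Jensen:
  fixes a :: "'i \<Rightarrow> real" and t :: "'i \<Rightarrow> ennreal"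
  assumes "finite I" and a: "\<And>i. i \<in> I \<Longrightarrow> 0 < a i" and "(\<Sum>i\<in>I. a i) = 1" and "1 \<le> r"
  shows "ennreal_powr (\<Sum>i\<in>I. ennreal (a i) * t i) r \<le> (\<Sum>i\<in>I. ennreal (a i) * ennreal_powr (t i) r)"
proof (cases "\<exists>i\<in>I. t i = top")
  case True
  then obtain i where "i \<in> I" "t i = top" by blast
  then have "ennreal (a i) * ennreal_powr (t i) r = top"
    using a[of i] by (auto simp: ennreal_mult_top)
  then have "(\<Sum>i\<in>I. ennreal (a i) * ennreal_powr (t i) r) = top"
    using \<open>finite I\<close> \<open>i \<in> I\<close> by (simp add: sum.remove[of I i])
  then show ?thesis by simp
next
  case False
  then have t: "t i = ennreal (enn2real (t i))" if "i \<in> I" for i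
    using that by (cases "t i") auto
  define u where "u i = enn2real (t i)" for i
  have t: "t i = ennreal (u i)" "0 \<le> u i" if "i \<in> I" for i
    using t that by (auto simp: u_def)
  have "I \<noteq> {}" using assms(3) by auto
  have "(\<Sum>i\<in>I. a i *\<^sub>R u i) powr r \<le> (\<Sum>i\<in>I. a i * u i powr r)"
    by (rule convex_on_sum[OF \<open>finite I\<close> \<open>I \<noteq> {}\<close>, of "{0..}"])
      (use assms t convex_on_powr_nonneg[of r] in \<open>auto intro: less_imp_le\<close>)
  then have "ennreal ((\<Sum>i\<in>I. a i * u i) powr r) \<le> ennreal (\<Sum>i\<in>I. a i * u i powr r)"
    by (intro ennreal_leI) simp
  moreover have "ennreal (\<Sum>i\<in>I. a i * u i) = (\<Sum>i\<in>I. ennreal (a i) * t i)"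
    using a t by (subst sum_ennreal[symmetric]) (auto simp: less_imp_le ennreal_mult intro!: sum.cong)
  moreover have "ennreal (\<Sum>i\<in>I. a i * u i powr r) = (\<Sum>i\<in>I. ennreal (a i) * ennreal_powr (t i) r)"
    using a t by (subst sum_ennreal[symmetric]) (auto simp: less_imp_le ennreal_mult intro!: sum.cong)
  moreover have "0 \<le> (\<Sum>i\<in>I. a i * u i)"
    using a t by (intro sum_nonneg) (auto simp: less_imp_le)
  ultimately show ?thesis
    by (metis ennreal_powr_ennreal)
qed

section \<open>The inequalities of Minkowski and Hoelder\<close>

text \<open>With \<open>b i\<close> the norm of \<open>g i\<close> and \<open>T\<close> the sum of the \<open>b i\<close>, the sum of the \<open>g i\<close> is the
  convex combination of the functions \<open>(T / b i) * g i\<close> with weights \<open>b i / T\<close>, and each of these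
  functions has norm at most \<open>T\<close>.\<close>

lemma nn_integral_Minkowski_sum:
  assumes "finite I" and "1 \<le> r" and [measurable]: "\<And>i. i \<in> I \<Longrightarrow> g i \<in> borel_measurable M"
  shows "ennreal_powr (\<integral>\<^sup>+x. ennreal_powr (\<Sum>i\<in>I. g i x) r \<partial>M) (1 / r)
    \<le> (\<Sum>i\<in>I. ennreal_powr (\<integral>\<^sup>+x. ennreal_powr (g i x) r \<partial>M) (1 / r))" (is "?L \<le> (\<Sum>i\<in>I. ?N i)")
proof (cases "I = {}")
  case False
  show ?thesis
  proof (rule ennreal_le_epsilon)
    fix e :: real
    assume fin: "(\<Sum>i\<in>I. ?N i) < top" and "0 < e"
    \<comment> \<open>The norms may vanish; enlarging each of them slightly makes all the divisions legitimate.\<close>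
    define b where "b i = enn2real (?N i) + e / card I" for i
    have "0 < card I" using \<open>finite I\<close> False by (simp add: card_gt_0_iff)
    then have b_pos: "0 < b i" for i
      unfolding b_def using \<open>0 < e\<close> by (intro add_nonneg_pos) auto
    define T where "T = (\<Sum>i\<in>I. b i)"
    have "0 < T" unfolding T_def using \<open>finite I\<close> False b_pos by (intro sum_pos) auto
    have N_eq: "?N i = ennreal (enn2real (?N i))" if "i \<in> I" for i
    proof -
      have "?N i \<le> (\<Sum>i\<in>I. ?N i)" using that \<open>finite I\<close> by (intro member_le_sum) auto
      then have "?N i < top" using fin by (rule le_less_trans)
      then show ?thesis by simp
    qed
    have Nb: "(\<integral>\<^sup>+x. ennreal_powr (g i x) r \<partial>M) \<le> ennreal (b i powr r)" if "i \<in> I" for i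
    proof -
      have "?N i \<le> ennreal (b i)"
        by (subst N_eq[OF that]) (use \<open>0 < e\<close> in \<open>auto simp: b_def intro!: ennreal_leI\<close>)
      then show ?thesis
        using ennreal_powr_le_iff[of "1 / r" "\<integral>\<^sup>+x. ennreal_powr (g i x) r \<partial>M" "ennreal (b i)"]
          assms(2) b_pos[of i] by (simp add: less_imp_le)
    qed
    have ptw: "ennreal_powr (\<Sum>i\<in>I. g i x) r
        \<le> (\<Sum>i\<in>I. ennreal (b i / T * (T / b i) powr r) * ennreal_powr (g i x) r)" for x
    proof -
      have "(\<Sum>i\<in>I. g i x) = (\<Sum>i\<in>I. ennreal (b i / T) * (ennreal (T / b i) * g i x))"
      proof (rule sum.cong)
        fix i
        have "ennreal (b i / T) * ennreal (T / b i) = 1"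
          using b_pos[of i] \<open>0 < T\<close> by (simp flip: ennreal_mult)
        then show "g i x = ennreal (b i / T) * (ennreal (T / b i) * g i x)"
          by (simp flip: mult.assoc)
      qed simp
      also have "ennreal_powr \<dots> r
          \<le> (\<Sum>i\<in>I. ennreal (b i / T) * ennreal_powr (ennreal (T / b i) * g i x) r)"
        using \<open>finite I\<close> b_pos \<open>0 < T\<close> assms(2)
        by (intro ennreal_powr_Jensen) (auto simp: T_def simp flip: sum_divide_distrib)
      also have "\<dots> = (\<Sum>i\<in>I. ennreal (b i / T * (T / b i) powr r) * ennreal_powr (g i x) r)"
        using b_pos \<open>0 < T\<close>
        by (intro sum.cong) (auto simp: ennreal_powr_mult less_imp_le simp flip: mult.assoc ennreal_mult)
      finally show ?thesis .
    qed
    have "(\<integral>\<^sup>+x. ennreal_powr (\<Sum>i\<in>I. g i x) r \<partial>M)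
        \<le> (\<integral>\<^sup>+x. (\<Sum>i\<in>I. ennreal (b i / T * (T / b i) powr r) * ennreal_powr (g i x) r) \<partial>M)"
      by (intro nn_integral_mono ptw)
    also have "\<dots> = (\<Sum>i\<in>I. ennreal (b i / T * (T / b i) powr r) * (\<integral>\<^sup>+x. ennreal_powr (g i x) r \<partial>M))"
      by (simp add: nn_integral_sum nn_integral_cmult)
    also have "\<dots> \<le> (\<Sum>i\<in>I. ennreal (b i / T * (T / b i) powr r) * ennreal (b i powr r))"
      by (intro sum_mono mult_left_mono Nb) auto
    also have "\<dots> = (\<Sum>i\<in>I. ennreal (b i / T * T powr r))"
    proof (rule sum.cong)
      fix i
      have "(T / b i) powr r * b i powr r = T powr r"
        using b_pos[of i] \<open>0 < T\<close> by (simp add: powr_divide)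
      then show "ennreal (b i / T * (T / b i) powr r) * ennreal (b i powr r) = ennreal (b i / T * T powr r)"
        using b_pos[of i] \<open>0 < T\<close> by (simp add: mult.assoc flip: ennreal_mult)
    qed simp
    also have "\<dots> = ennreal (T powr r)"
      using b_pos \<open>0 < T\<close>
      by (subst sum_ennreal) (auto simp: less_imp_le T_def simp flip: sum_divide_distrib sum_distrib_right)
    finally have "?L \<le> ennreal T"
      using ennreal_powr_le_iff[of "1 / r" _ "ennreal T"] assms(2) \<open>0 < T\<close> by (simp add: less_imp_le)
    also have "ennreal T = (\<Sum>i\<in>I. ennreal (enn2real (?N i))) + ennreal e"
      using \<open>0 < card I\<close> \<open>0 < e\<close> by (simp add: T_def b_def sum.distrib sum_nonneg)
    also have "\<dots> = (\<Sum>i\<in>I. ?N i) + ennreal e"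
      using N_eq by simp
    finally show "?L \<le> (\<Sum>i\<in>I. ?N i) + ennreal e" .
  qed
qed simp

text \<open>Monotone convergence is about sequences, so unordered sums are written as limits of an
  increasing sequence of partial sums. The enumeration of a finite set repeats elements, and
  summing over its image keeps the statement valid in that case.\<close>

lemma infsum_ennreal_eq_SUP:
  fixes f :: "'i \<Rightarrow> ennreal"
  assumes "countable I" and "I \<noteq> {}"
  shows "infsum f I = (SUP n. sum f (from_nat_into I ` {..<n}))"
proof -
  have *: "infsum f I = (SUP F\<in>{F. finite F \<and> F \<subseteq> I}. sum f F)"
    by (intro nonneg_infsum_complete) auto
  show ?thesis
  proof (rule antisym)
    show "infsum f I \<le> (SUP n. sum f (from_nat_into I ` {..<n}))"
      unfolding *
    proof (rule SUP_least)
      fix F assume F: "F \<in> {F. finite F \<and> F \<subseteq> I}"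
      define n where "n = Suc (Max (insert 0 (to_nat_on I ` F)))"
      have "F \<subseteq> from_nat_into I ` {..<n}"
      proof
        fix i assume "i \<in> F"
        then have "to_nat_on I i < n" using F by (auto simp: n_def less_Suc_eq_le intro!: Max_ge)
        moreover have "from_nat_into I (to_nat_on I i) = i"
          using F \<open>i \<in> F\<close> assms by auto
        ultimately show "i \<in> from_nat_into I ` {..<n}" by force
      qed
      then have "sum f F \<le> sum f (from_nat_into I ` {..<n})"
        by (intro sum_mono2) auto
      also have "\<dots> \<le> (SUP n. sum f (from_nat_into I ` {..<n}))" by (intro SUP_upper) auto
      finally show "sum f F \<le> (SUP n. sum f (from_nat_into I ` {..<n}))" .
    qed
    show "(SUP n. sum f (from_nat_into I ` {..<n})) \<le> infsum f I"
      unfolding * using from_nat_into[OF assms(2)] by (intro SUP_mono) (auto intro!: bexI)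
  qed
qed

lemma sum_le_infsum_ennreal:
  fixes f :: "'i \<Rightarrow> ennreal"
  assumes "finite F" "F \<subseteq> I"
  shows "sum f F \<le> infsum f I"
  using assms by (subst nonneg_infsum_complete) (auto intro!: SUP_upper)

lemma infsum_ennreal_le:
  fixes f :: "'i \<Rightarrow> ennreal"
  assumes "\<And>F. finite F \<Longrightarrow> F \<subseteq> I \<Longrightarrow> sum f F \<le> X"
  shows "infsum f I \<le> X"
  using assms by (subst nonneg_infsum_complete) (auto intro!: SUP_least)

lemma borel_measurable_infsum_ennreal:
  fixes g :: "'i \<Rightarrow> 'a \<Rightarrow> ennreal"
  assumes "countable I" and [measurable]: "\<And>i. i \<in> I \<Longrightarrow> g i \<in> borel_measurable M"
  shows "(\<lambda>x. \<Sum>\<^sub>\<infinity>i\<in>I. g i x) \<in> borel_measurable M"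
proof (cases "I = {}")
  case False
  then have [measurable]: "g (from_nat_into I n) \<in> borel_measurable M" for n
    using from_nat_into[OF False] by auto
  have "(\<lambda>x. SUP n. \<Sum>i\<in>from_nat_into I ` {..<n}. g i x) \<in> borel_measurable M"
    by (intro borel_measurable_SUP borel_measurable_sum) auto
  then show ?thesis
    by (simp add: infsum_ennreal_eq_SUP[OF assms(1) False])
qed simp

lemma nn_integral_Minkowski:
  fixes g :: "'i \<Rightarrow> 'a \<Rightarrow> ennreal"
  assumes "countable I" and "1 \<le> r" and [measurable]: "\<And>i. i \<in> I \<Longrightarrow> g i \<in> borel_measurable M"
  shows "ennreal_powr (\<integral>\<^sup>+x. ennreal_powr (\<Sum>\<^sub>\<infinity>i\<in>I. g i x) r \<partial>M) (1 / r)
    \<le> (\<Sum>\<^sub>\<infinity>i\<in>I. ennreal_powr (\<integral>\<^sup>+x. ennreal_powr (g i x) r \<partial>M) (1 / r))"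
    (is "_ \<le> ?R")
proof (cases "I = {}")
  case False
  define F where "F n = from_nat_into I ` {..<n}" for n
  have F: "finite (F n)" "F n \<subseteq> I" for n
    using from_nat_into[OF False] by (auto simp: F_def)
  have F_mono: "m \<le> n \<Longrightarrow> F m \<subseteq> F n" for m n by (auto simp: F_def)
  have [measurable]: "i \<in> F n \<Longrightarrow> g i \<in> borel_measurable M" for i n using F(2)[of n] by auto
  have "(\<integral>\<^sup>+x. ennreal_powr (\<Sum>\<^sub>\<infinity>i\<in>I. g i x) r \<partial>M)
      = (\<integral>\<^sup>+x. (SUP n. ennreal_powr (\<Sum>i\<in>F n. g i x) r) \<partial>M)"
    using assms(2) by (simp add: infsum_ennreal_eq_SUP[OF assms(1) False] F_def ennreal_powr_SUP)
  also have "\<dots> = (SUP n. \<integral>\<^sup>+x. ennreal_powr (\<Sum>i\<in>F n. g i x) r \<partial>M)"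
    using assms(2) F F_mono
    by (intro nn_integral_monotone_convergence_SUP)
      (auto simp: incseq_def le_fun_def intro!: ennreal_powr_mono sum_mono2 dest: subsetD[OF F_mono])
  finally have "ennreal_powr (\<integral>\<^sup>+x. ennreal_powr (\<Sum>\<^sub>\<infinity>i\<in>I. g i x) r \<partial>M) (1 / r)
      = (SUP n. ennreal_powr (\<integral>\<^sup>+x. ennreal_powr (\<Sum>i\<in>F n. g i x) r \<partial>M) (1 / r))"
    using assms(2) by (simp add: ennreal_powr_SUP)
  also have "\<dots> \<le> ?R"
  proof (rule SUP_least)
    fix n
    show "ennreal_powr (\<integral>\<^sup>+x. ennreal_powr (\<Sum>i\<in>F n. g i x) r \<partial>M) (1 / r) \<le> ?R"
      using nn_integral_Minkowski_sum[OF F(1)[of n] assms(2)]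
        sum_le_infsum_ennreal[OF F] by (rule order_trans) auto
  qed
  finally show ?thesis .
qed simp

text \<open>This is Minkowski's inequality with the roles of sum and integral exchanged. With
  \<open>b i\<close> the integral of \<open>h i\<close> and \<open>S\<close> the sum of the \<open>b i powr r\<close>, Jensen's inequality with the
  weights \<open>b i powr r / S\<close> bounds the convex combination of the functions \<open>h i / b i\<close>, which has
  integral \<open>1\<close>, by the integrand on the right divided by \<open>S powr (1 / r)\<close>.\<close>

lemma nn_integral_reverse_Minkowski_sum:
  fixes h :: "'i \<Rightarrow> 'a \<Rightarrow> ennreal"
  assumes "finite I" and "1 \<le> r" and [measurable]: "\<And>i. i \<in> I \<Longrightarrow> h i \<in> borel_measurable M"
  shows "(\<Sum>i\<in>I. ennreal_powr (\<integral>\<^sup>+x. h i x \<partial>M) r)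
    \<le> ennreal_powr (\<integral>\<^sup>+x. ennreal_powr (\<Sum>i\<in>I. ennreal_powr (h i x) r) (1 / r) \<partial>M) r"
proof -
  define B where "B i = (\<integral>\<^sup>+x. h i x \<partial>M)" for i
  define H where "H J x = ennreal_powr (\<Sum>i\<in>J. ennreal_powr (h i x) r) (1 / r)" for J x
  have H_mono: "H J x \<le> H I x" if "J \<subseteq> I" for J x
    unfolding H_def using that assms(1,2) by (intro ennreal_powr_mono sum_mono2) auto
  have [measurable]: "J \<subseteq> I \<Longrightarrow> H J \<in> borel_measurable M" for J
    unfolding H_def by (intro borel_measurable_ennreal_powr borel_measurable_sum) auto
  have "(\<Sum>i\<in>I. ennreal_powr (B i) r) \<le> ennreal_powr (\<integral>\<^sup>+x. H I x \<partial>M) r"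
  proof (cases "\<exists>i\<in>I. B i = top")
    case True
    then obtain i where i: "i \<in> I" "B i = top" by blast
    have "h i x = H {i} x" for x
      using assms(2) by (simp add: H_def ennreal_powr_powr)
    then have "B i \<le> (\<integral>\<^sup>+x. H I x \<partial>M)"
      unfolding B_def using i by (auto intro!: nn_integral_mono H_mono)
    then show ?thesis using i by (simp add: top_unique)
  next
    case False
    define b where "b i = enn2real (B i)" for i
    \<comment> \<open>Jensen's inequality divides by the integrals, so the vanishing ones are dropped.\<close>
    define J where "J = {i\<in>I. B i \<noteq> 0}"
    have J: "finite J" "J \<subseteq> I" using assms(1) by (auto simp: J_def)
    have b: "B i = ennreal (b i)" "0 < b i" if "i \<in> J" for i
      using that False by (cases "B i"; force simp: J_def b_def)+
    have b_powr: "0 < b i powr r" if "i \<in> J" for i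
      using b(2)[OF that] by simp
    define S where "S = (\<Sum>i\<in>J. b i powr r)"
    have B_sum: "(\<Sum>i\<in>I. ennreal_powr (B i) r) = ennreal S"
    proof -
      have "(\<Sum>i\<in>I. ennreal_powr (B i) r) = (\<Sum>i\<in>J. ennreal_powr (B i) r)"
        using assms(1) by (intro sum.mono_neutral_right) (auto simp: J_def)
      also have "\<dots> = (\<Sum>i\<in>J. ennreal (b i powr r))"
        using b by (intro sum.cong) (auto simp: less_imp_le)
      finally show ?thesis by (simp add: S_def sum_ennreal)
    qed
    show ?thesis
    proof (cases "J = {}")
      case False
      have "0 < S" unfolding S_def using J False b by (intro sum_pos b_powr)
      define T where "T = S powr (1 / r)"
      have "0 < T" using \<open>0 < S\<close> by (simp add: T_def)
      have ptw: "(\<Sum>i\<in>J. ennreal (b i powr r / S / b i) * h i x) \<le> ennreal (1 / T) * H I x" for x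
      proof -
        have "ennreal_powr (\<Sum>i\<in>J. ennreal (b i powr r / S / b i) * h i x) r
            = ennreal_powr (\<Sum>i\<in>J. ennreal (b i powr r / S) * (ennreal (1 / b i) * h i x)) r"
          using b \<open>0 < S\<close>
          by (intro arg_cong2[where f = ennreal_powr] sum.cong)
            (auto simp: less_imp_le simp flip: mult.assoc ennreal_mult)
        also have "\<dots> \<le> (\<Sum>i\<in>J. ennreal (b i powr r / S) * ennreal_powr (ennreal (1 / b i) * h i x) r)"
          using J b \<open>0 < S\<close> assms(2)
          by (intro ennreal_powr_Jensen divide_pos_pos b_powr) (auto simp: S_def simp flip: sum_divide_distrib)
        also have "\<dots> = (\<Sum>i\<in>J. ennreal (1 / S) * ennreal_powr (h i x) r)"
        proof (rule sum.cong)
          fix i assume "i \<in> J"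
          then have "ennreal (b i powr r / S) * ennreal ((1 / b i) powr r) = ennreal (1 / S)"
            using b[of i] \<open>0 < S\<close> by (simp add: powr_divide flip: ennreal_mult)
          then show "ennreal (b i powr r / S) * ennreal_powr (ennreal (1 / b i) * h i x) r
              = ennreal (1 / S) * ennreal_powr (h i x) r"
            using b[OF \<open>i \<in> J\<close>] by (simp add: ennreal_powr_mult less_imp_le flip: mult.assoc)
        qed simp
        also have "\<dots> = ennreal (1 / S) * (\<Sum>i\<in>J. ennreal_powr (h i x) r)"
          by (simp add: sum_distrib_left)
        finally have "(\<Sum>i\<in>J. ennreal (b i powr r / S / b i) * h i x)
            \<le> ennreal_powr (ennreal (1 / S) * (\<Sum>i\<in>J. ennreal_powr (h i x) r)) (1 / r)"
          using assms(2) by (subst (asm) ennreal_powr_le_iff) auto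
        also have "\<dots> = ennreal (1 / T) * H J x"
          using \<open>0 < S\<close> by (simp add: ennreal_powr_mult H_def T_def powr_divide less_imp_le)
        also have "\<dots> \<le> ennreal (1 / T) * H I x"
          by (intro mult_left_mono H_mono J) auto
        finally show ?thesis .
      qed
      have "1 = (\<Sum>i\<in>J. ennreal (b i powr r / S / b i) * B i)"
      proof -
        have "(\<Sum>i\<in>J. ennreal (b i powr r / S / b i) * B i) = (\<Sum>i\<in>J. ennreal (b i powr r / S))"
        proof (rule sum.cong)
          fix i assume "i \<in> J"
          then show "ennreal (b i powr r / S / b i) * B i = ennreal (b i powr r / S)"
            using b[of i] \<open>0 < S\<close> by (simp add: less_imp_le flip: ennreal_mult)
        qed simp
        also have "\<dots> = 1"
          using \<open>0 < S\<close> by (subst sum_ennreal) (auto simp: S_def simp flip: sum_divide_distrib)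
        finally show ?thesis by simp
      qed
      also have "\<dots> = (\<integral>\<^sup>+x. (\<Sum>i\<in>J. ennreal (b i powr r / S / b i) * h i x) \<partial>M)"
        using J by (subst nn_integral_sum) (auto simp: B_def nn_integral_cmult subset_eq intro!: sum.cong)
      also have "\<dots> \<le> (\<integral>\<^sup>+x. ennreal (1 / T) * H I x \<partial>M)"
        by (intro nn_integral_mono ptw)
      also have "\<dots> = ennreal (1 / T) * (\<integral>\<^sup>+x. H I x \<partial>M)"
        by (simp add: nn_integral_cmult)
      finally have "ennreal T * 1 \<le> ennreal T * (ennreal (1 / T) * (\<integral>\<^sup>+x. H I x \<partial>M))"
        by (rule mult_left_mono) simp
      also have "\<dots> = (\<integral>\<^sup>+x. H I x \<partial>M)"
        using \<open>0 < T\<close> by (simp flip: mult.assoc ennreal_mult)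
      finally have "ennreal_powr (ennreal T) r \<le> ennreal_powr (\<integral>\<^sup>+x. H I x \<partial>M) r"
        using assms(2) by (intro ennreal_powr_mono) auto
      then show ?thesis
        using \<open>0 < S\<close> assms(2) by (simp add: B_sum T_def powr_powr)
    qed (simp add: B_sum S_def)
  qed
  then show ?thesis by (simp add: B_def H_def)
qed

text \<open>Hoelder's inequality against the function \<open>1\<close> on \<open>A\<close>. Young's inequality for
  \<open>u x / l\<close> and \<open>1\<close> is integrated, where \<open>l\<close> is the constant value that \<open>u\<close> would need
  on \<open>A\<close> to have the same integral of the \<open>p\<close>-th power: this is the case of equality.\<close>

lemma nn_integral_Hoelder_indicator:
  assumes "1 < p" and [measurable]: "u \<in> borel_measurable M" "A \<in> sets M"
  shows "(\<integral>\<^sup>+x. u x * indicator A x \<partial>M)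
    \<le> ennreal_powr (\<integral>\<^sup>+x. ennreal_powr (u x) p * indicator A x \<partial>M) (1 / p)
      * ennreal_powr (emeasure M A) (1 / hoelder_conjugate p)"
proof -
  define B where "B = (\<integral>\<^sup>+x. ennreal_powr (u x) p * indicator A x \<partial>M)"
  have q: "1 / hoelder_conjugate p = 1 - 1 / p"
    using assms(1) by (simp add: hoelder_conjugate_def field_simps)
  have "0 < 1 - 1 / p" using assms(1) by simp
  consider "B = 0" | "emeasure M A = 0" | "B = top" "emeasure M A \<noteq> 0"
    | "emeasure M A = top" "B \<noteq> 0"
    | b m where "B = ennreal b" "emeasure M A = ennreal m" "0 < b" "0 < m"
    by (cases B; cases "emeasure M A"; force simp: order_less_le)
  then show ?thesis
  proof cases
    case 1
    then have "AE x in M. ennreal_powr (u x) p * indicator A x = 0"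
      unfolding B_def by (subst (asm) nn_integral_0_iff_AE) auto
    then have "AE x in M. u x * indicator A x = 0"
      by eventually_elim auto
    then have "(\<integral>\<^sup>+x. u x * indicator A x \<partial>M) = 0"
      by (subst nn_integral_0_iff_AE) auto
    then show ?thesis by simp
  next
    case 2
    then have "A \<in> null_sets M" by auto
    then have "AE x in M. u x * indicator A x = 0"
      using AE_not_in by fastforce
    then have "(\<integral>\<^sup>+x. u x * indicator A x \<partial>M) = 0"
      by (subst nn_integral_0_iff_AE) auto
    then show ?thesis by simp
  next
    case 3
    then show ?thesis by (simp add: B_def[symmetric] ennreal_top_mult)
  next
    case 4
    then show ?thesis by (simp add: B_def[symmetric] ennreal_mult_top)
  next
    case (5 b m)
    define l where "l = (b / m) powr (1 / p)"
    have "0 < l" using 5 by (simp add: l_def)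
    have lp: "l powr p = b / m" using assms(1) 5 by (simp add: l_def powr_powr)
    have young: "t \<le> ennreal (l powr (1 - p) / p) * ennreal_powr t p + ennreal (l * (1 - 1 / p))" for t
    proof (cases t)
      case (real s)
      have "s / l * 1 \<le> (s / l) powr p / p + 1 powr (hoelder_conjugate p) / hoelder_conjugate p"
        using assms(1) real \<open>0 < l\<close> q
        by (intro Youngs_inequality) (auto simp: hoelder_conjugate_def field_simps)
      then have "s \<le> l * ((s / l) powr p / p + (1 - 1 / p))"
        using \<open>0 < l\<close> q by (simp add: field_simps)
      also have "\<dots> = l powr (1 - p) / p * s powr p + l * (1 - 1 / p)"
        using \<open>0 < l\<close> real by (simp add: powr_divide powr_diff distrib_left)
      finally have "ennreal s \<le> ennreal (l powr (1 - p) / p * s powr p + l * (1 - 1 / p))"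
        by (rule ennreal_leI)
      also have "\<dots> = ennreal (l powr (1 - p) / p) * ennreal_powr t p + ennreal (l * (1 - 1 / p))"
        using real assms(1) \<open>0 < l\<close> \<open>0 < 1 - 1 / p\<close>
        by (subst ennreal_plus) (auto simp del: ennreal_plus simp flip: ennreal_mult)
      finally show ?thesis using real by simp
    qed (use \<open>0 < l\<close> assms(1) in \<open>auto simp: ennreal_mult_top\<close>)
    have "(\<integral>\<^sup>+x. u x * indicator A x \<partial>M)
        \<le> (\<integral>\<^sup>+x. ennreal (l powr (1 - p) / p) * (ennreal_powr (u x) p * indicator A x)
              + ennreal (l * (1 - 1 / p)) * indicator A x \<partial>M)"
      using young by (intro nn_integral_mono) (auto split: split_indicator)
    also have "\<dots> = ennreal (l powr (1 - p) / p) * B + ennreal (l * (1 - 1 / p)) * emeasure M A"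
      by (simp add: nn_integral_add nn_integral_cmult B_def)
    also have "\<dots> = ennreal (l powr (1 - p) / p * b + l * (1 - 1 / p) * m)"
      using 5 \<open>0 < l\<close> assms(1) \<open>0 < 1 - 1 / p\<close>
      by (subst ennreal_plus) (auto simp del: ennreal_plus simp flip: ennreal_mult)
    also have "l powr (1 - p) / p * b + l * (1 - 1 / p) * m = l * m"
    proof -
      have "l powr (1 - p) * b = l * m"
        using \<open>0 < l\<close> 5 lp by (simp add: powr_diff field_simps)
      then show ?thesis by (simp add: field_simps)
    qed
    also have "l * m = b powr (1 / p) * m powr (1 - 1 / p)"
      using 5 by (simp add: l_def powr_divide powr_diff)
    finally show ?thesis
      using 5 by (simp add: B_def[symmetric] q ennreal_mult)
  qed
qed

section \<open>Sufficiency\<close>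

text \<open>Boundedness of the cubes makes locally integrable functions integrable over them, and the
  positive volume makes the division by \<open>measure lborel Q\<close> a genuine average. Countability is what
  Minkowski's inequality for infinite sums rests on.\<close>

lemma averages_square_function_le:
  fixes \<D> :: "(real ^ 'n) set set"
  assumes "countable \<D>"
    and \<D>: "\<And>Q. Q \<in> \<D> \<Longrightarrow> Q \<in> sets borel" "\<And>Q. Q \<in> \<D> \<Longrightarrow> bounded Q"
      "\<And>Q. Q \<in> \<D> \<Longrightarrow> 0 < measure lborel Q"
    and \<sigma>: "sets \<sigma> = sets borel" and w: "sets w = sets borel"
    and p: "1 < p" "p \<le> 2" and q: "2 \<le> q"
    and f: "\<And>Q. Q \<in> \<D> \<Longrightarrow> locally_integrable \<sigma> (f Q)"
  shows "Lp_norm q w (square_function \<D> (\<lambda>Q x. (LINT y:Q|\<sigma>. f Q y) / measure lborel Q))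
    \<le> simple_A \<D> p q \<sigma> w * Lp_norm p \<sigma> (square_function \<D> f)"
proof -
  define c where "c Q = (LINT y:Q|\<sigma>. f Q y) / measure lborel Q" for Q
  define u where "u Q y = ennreal \<bar>indicator Q y * f Q y\<bar>" for Q y
  define b where "b Q = (\<integral>\<^sup>+y. ennreal_powr (u Q y) p \<partial>\<sigma>)" for Q
  define A where "A = simple_A \<D> p q \<sigma> w"
  define N where "N = Lp_norm p \<sigma> (square_function \<D> f)"
  have [measurable]: "Q \<in> sets \<sigma>" "Q \<in> sets w" if "Q \<in> \<D>" for Q
    using \<D>(1)[OF that] \<sigma> w by auto
  have int: "integrable \<sigma> (\<lambda>y. indicator Q y * f Q y)" if "Q \<in> \<D>" for Q
  proof -
    have "set_integrable \<sigma> (closure Q) (f Q)"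
      using f[OF that] \<D>(2)[OF that] by (simp add: locally_integrable_def)
    then have "set_integrable \<sigma> Q (f Q)"
      by (rule set_integrable_subset) (use that closure_subset in auto)
    then show ?thesis by (simp add: set_integrable_def)
  qed
  have [measurable]: "u Q \<in> borel_measurable \<sigma>" if "Q \<in> \<D>" for Q
    using borel_measurable_integrable[OF int[OF that]] unfolding u_def by measurable
  have u_sq: "(u Q y)\<^sup>2 = ennreal ((f Q y)\<^sup>2) * indicator Q y" for Q y
    by (simp add: u_def ennreal_power split: split_indicator)
  \<comment> \<open>Hoelder's inequality and the \<open>A\<close>-condition, cube by cube\<close>
  have weighted: "ennreal \<bar>c Q\<bar> * ennreal_powr (emeasure w Q) (1 / q) \<le> A * ennreal_powr (b Q) (1 / p)"
    if Q: "Q \<in> \<D>" for Q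
  proof -
    have fin: "emeasure lborel Q = ennreal (measure lborel Q)"
      using emeasure_bounded_finite[OF \<D>(2)[OF Q]] by (intro emeasure_eq_ennreal_measure) auto
    have "ennreal \<bar>LINT y:Q|\<sigma>. f Q y\<bar> \<le> (\<integral>\<^sup>+y. u Q y \<partial>\<sigma>)"
      using integral_norm_bound_ennreal[OF int[OF Q]]
      by (simp add: set_lebesgue_integral_def u_def)
    also have "\<dots> = (\<integral>\<^sup>+y. u Q y * indicator Q y \<partial>\<sigma>)"
      by (intro nn_integral_cong) (auto simp: u_def split: split_indicator)
    also have "\<dots> \<le> ennreal_powr (\<integral>\<^sup>+y. ennreal_powr (u Q y) p * indicator Q y \<partial>\<sigma>) (1 / p)
        * ennreal_powr (emeasure \<sigma> Q) (1 / hoelder_conjugate p)"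
      using p(1) Q by (intro nn_integral_Hoelder_indicator) auto
    also have "(\<integral>\<^sup>+y. ennreal_powr (u Q y) p * indicator Q y \<partial>\<sigma>) = b Q"
      unfolding b_def by (intro nn_integral_cong) (auto simp: u_def split: split_indicator)
    finally have hoelder: "ennreal \<bar>LINT y:Q|\<sigma>. f Q y\<bar>
        \<le> ennreal_powr (b Q) (1 / p) * ennreal_powr (emeasure \<sigma> Q) (1 / hoelder_conjugate p)" .
    have "ennreal \<bar>c Q\<bar> = ennreal \<bar>LINT y:Q|\<sigma>. f Q y\<bar> / emeasure lborel Q"
      using \<D>(3)[OF Q] by (simp add: c_def fin divide_ennreal)
    then have "ennreal \<bar>c Q\<bar> * ennreal_powr (emeasure w Q) (1 / q)
        \<le> ennreal_powr (b Q) (1 / p) * ennreal_powr (emeasure \<sigma> Q) (1 / hoelder_conjugate p)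
          / emeasure lborel Q * ennreal_powr (emeasure w Q) (1 / q)"
      using hoelder by (auto intro!: mult_right_mono divide_right_mono_ennreal)
    also have "\<dots> = ennreal_powr (b Q) (1 / p) * (ennreal_powr (emeasure \<sigma> Q) (1 / hoelder_conjugate p)
          * ennreal_powr (emeasure w Q) (1 / q) / emeasure lborel Q)"
      by (simp add: divide_ennreal_def mult_ac)
    also have "\<dots> \<le> ennreal_powr (b Q) (1 / p) * A"
      unfolding A_def simple_A_def using Q by (intro mult_left_mono SUP_upper) auto
    finally show ?thesis by (simp add: mult.commute)
  qed
  define g where "g Q x = ennreal ((c Q)\<^sup>2) * indicator Q x" for Q x
  \<comment> \<open>the \<open>L^(q/2)(w)\<close> norms of the individual terms of the left-hand square function\<close>
  have g_norm: "ennreal_powr (\<integral>\<^sup>+x. ennreal_powr (g Q x) (q / 2) \<partial>w) (1 / (q / 2))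
      \<le> ennreal_powr A 2 * ennreal_powr (b Q) (2 / p)" if Q: "Q \<in> \<D>" for Q
  proof -
    have "(\<integral>\<^sup>+x. ennreal_powr (g Q x) (q / 2) \<partial>w)
        = (\<integral>\<^sup>+x. ennreal_powr (ennreal ((c Q)\<^sup>2)) (q / 2) * indicator Q x \<partial>w)"
      by (intro nn_integral_cong) (auto simp: g_def split: split_indicator)
    also have "\<dots> = ennreal_powr (ennreal ((c Q)\<^sup>2)) (q / 2) * emeasure w Q"
      using Q by (simp add: nn_integral_cmult)
    finally have "ennreal_powr (\<integral>\<^sup>+x. ennreal_powr (g Q x) (q / 2) \<partial>w) (1 / (q / 2))
        = ennreal ((c Q)\<^sup>2) * ennreal_powr (emeasure w Q) (1 / (q / 2))"
      using q by (simp add: ennreal_powr_mult ennreal_powr_powr del: ennreal_powr_ennreal)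
    also have "ennreal ((c Q)\<^sup>2) = ennreal_powr (ennreal \<bar>c Q\<bar>) 2"
      by (simp add: ennreal_powr_two ennreal_power del: ennreal_powr_ennreal)
    also have "ennreal_powr (ennreal \<bar>c Q\<bar>) 2 * ennreal_powr (emeasure w Q) (1 / (q / 2))
        = ennreal_powr (ennreal \<bar>c Q\<bar> * ennreal_powr (emeasure w Q) (1 / q)) 2"
      by (simp add: ennreal_powr_mult ennreal_powr_powr)
    also have "\<dots> \<le> ennreal_powr (A * ennreal_powr (b Q) (1 / p)) 2"
      using weighted[OF Q] by (intro ennreal_powr_mono) auto
    also have "\<dots> = ennreal_powr A 2 * ennreal_powr (b Q) (2 / p)"
      by (simp add: ennreal_powr_mult ennreal_powr_powr)
    finally show ?thesis .
  qed
  \<comment> \<open>Reversed Minkowski with exponent \<open>2 / p\<close>; finite sums suffice, since the right-hand side is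
    already the full norm.\<close>
  have sum_le: "(\<Sum>Q\<in>F. ennreal_powr (b Q) (2 / p)) \<le> ennreal_powr N 2"
    if F: "finite F" "F \<subseteq> \<D>" for F
  proof -
    have "(\<Sum>Q\<in>F. ennreal_powr (b Q) (2 / p))
        \<le> ennreal_powr (\<integral>\<^sup>+y. ennreal_powr
            (\<Sum>Q\<in>F. ennreal_powr (ennreal_powr (u Q y) p) (2 / p)) (1 / (2 / p)) \<partial>\<sigma>) (2 / p)"
      unfolding b_def using F p
      by (intro nn_integral_reverse_Minkowski_sum borel_measurable_ennreal_powr) auto
    also have "\<dots> \<le> ennreal_powr (\<integral>\<^sup>+y. ennreal_powr (square_function \<D> f y) p \<partial>\<sigma>) (2 / p)"
    proof (intro ennreal_powr_mono nn_integral_mono)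
      fix y
      have "(\<Sum>Q\<in>F. ennreal_powr (ennreal_powr (u Q y) p) (2 / p))
          = (\<Sum>Q\<in>F. ennreal ((f Q y)\<^sup>2) * indicator Q y)"
        using p by (simp add: ennreal_powr_powr ennreal_powr_two u_sq)
      also have "\<dots> \<le> (\<Sum>\<^sub>\<infinity>Q\<in>\<D>. ennreal ((f Q y)\<^sup>2) * indicator Q y)"
        by (rule sum_le_infsum_ennreal[OF F])
      finally show "ennreal_powr (\<Sum>Q\<in>F. ennreal_powr (ennreal_powr (u Q y) p) (2 / p)) (1 / (2 / p))
          \<le> ennreal_powr (square_function \<D> f y) p"
        using p by (simp add: square_function_def ennreal_powr_powr ennreal_powr_mono)
    qed (use p in auto)
    also have "\<dots> = ennreal_powr N 2"
      using p by (simp add: N_def Lp_norm_def ennreal_powr_powr)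
    finally show ?thesis .
  qed
  have "Lp_norm q w (square_function \<D> (\<lambda>Q x. c Q))
      = ennreal_powr (ennreal_powr (\<integral>\<^sup>+x. ennreal_powr (\<Sum>\<^sub>\<infinity>Q\<in>\<D>. g Q x) (q / 2) \<partial>w) (1 / (q / 2))) (1 / 2)"
    by (simp add: Lp_norm_def square_function_def ennreal_powr_powr g_def)
  also have "\<dots> \<le> ennreal_powr (\<Sum>\<^sub>\<infinity>Q\<in>\<D>.
      ennreal_powr (\<integral>\<^sup>+x. ennreal_powr (g Q x) (q / 2) \<partial>w) (1 / (q / 2))) (1 / 2)"
    using q by (intro ennreal_powr_mono nn_integral_Minkowski \<open>countable \<D>\<close>) (auto simp: g_def)
  also have "\<dots> \<le> ennreal_powr (ennreal_powr A 2 * ennreal_powr N 2) (1 / 2)"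
  proof (intro ennreal_powr_mono infsum_ennreal_le)
    fix F assume F: "finite F" "F \<subseteq> \<D>"
    have "(\<Sum>Q\<in>F. ennreal_powr (\<integral>\<^sup>+x. ennreal_powr (g Q x) (q / 2) \<partial>w) (1 / (q / 2)))
        \<le> (\<Sum>Q\<in>F. ennreal_powr A 2 * ennreal_powr (b Q) (2 / p))"
      using F g_norm by (intro sum_mono) auto
    also have "\<dots> = ennreal_powr A 2 * (\<Sum>Q\<in>F. ennreal_powr (b Q) (2 / p))"
      by (simp add: sum_distrib_left)
    also have "\<dots> \<le> ennreal_powr A 2 * ennreal_powr N 2"
      by (intro mult_left_mono sum_le F) auto
    finally show "(\<Sum>Q\<in>F. ennreal_powr (\<integral>\<^sup>+x. ennreal_powr (g Q x) (q / 2) \<partial>w) (1 / (q / 2)))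
        \<le> ennreal_powr A 2 * ennreal_powr N 2" .
  qed simp
  also have "\<dots> = A * N"
    by (simp add: ennreal_powr_mult ennreal_powr_powr)
  finally show ?thesis by (simp add: c_def A_def N_def)
qed

section \<open>Cubes of a dyadic lattice\<close>

text \<open>The open and the closed cube have the same volume, and this gives that of the half-open
  cube without a separate computation.\<close>

lemma half_open_cube_bounds:
  fixes x :: "real ^ 'n"
  shows
  "box x (x + l *\<^sub>R One) \<subseteq> half_open_cube x l" "half_open_cube x l \<subseteq> cbox x (x + l *\<^sub>R One)"
proof -
  have "(One :: real ^ 'n) $ i = 1" for i
    by (simp add: cart_eq_inner_axis)
  then show "box x (x + l *\<^sub>R One) \<subseteq> half_open_cube x l"
    "half_open_cube x l \<subseteq> cbox x (x + l *\<^sub>R One)"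
    by (auto simp: half_open_cube_def mem_box_cart less_imp_le simp del: sum_component)
qed

lemma half_open_cube_borel [measurable]: "half_open_cube x l \<in> sets borel"
proof -
  have "half_open_cube x l = (\<Inter>i. {y. x $ i \<le> y $ i} \<inter> {y. y $ i < x $ i + l})"
    by (auto simp: half_open_cube_def)
  also have "\<dots> \<in> sets borel"
    by (intro sets.countable_INT'' sets.Int borel_closed borel_open
        closed_halfspace_component_ge_cart open_halfspace_component_lt_cart) auto
  finally show ?thesis .
qed

lemma emeasure_half_open_cube:
  fixes x :: "real ^ 'n"
  assumes "0 < l"
  shows "emeasure lborel (half_open_cube x l) = ennreal (l ^ CARD('n))"
proof (rule antisym)
  have "emeasure lborel (half_open_cube x l) \<le> emeasure lborel (cbox x (x + l *\<^sub>R One))"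
    by (intro emeasure_mono half_open_cube_bounds) auto
  also have "\<dots> = ennreal (l ^ CARD('n))"
    using assms by (subst emeasure_lborel_cbox) (auto simp: inner_add_left)
  finally show "emeasure lborel (half_open_cube x l) \<le> ennreal (l ^ CARD('n))" .
  have "ennreal (l ^ CARD('n)) = emeasure lborel (box x (x + l *\<^sub>R One))"
    using assms by (subst emeasure_lborel_box) (auto simp: inner_add_left)
  also have "\<dots> \<le> emeasure lborel (half_open_cube x l)"
    by (intro emeasure_mono half_open_cube_bounds) auto
  finally show "ennreal (l ^ CARD('n)) \<le> emeasure lborel (half_open_cube x l)" .
qed

lemma measure_half_open_cube:
  fixes x :: "real ^ 'n"
  assumes "0 < l"
  shows "measure lborel (half_open_cube x l) = l ^ CARD('n)"
  using assms by (simp add: measure_def emeasure_half_open_cube)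

lemma bounded_half_open_cube: "bounded (half_open_cube x l)"
  using half_open_cube_bounds(2) bounded_cbox bounded_subset by blast

lemma interior_half_open_cube_ne:
  fixes x :: "real ^ 'n"
  assumes "0 < l"
  shows "interior (half_open_cube x l) \<noteq> {}"
proof -
  have "box x (x + l *\<^sub>R One) \<noteq> {}"
    using assms by (auto simp: box_ne_empty inner_add_left)
  then show ?thesis
    using interior_maximal[OF half_open_cube_bounds(1) open_box] by blast
qed

lemma dyadic_lattice_cubes:
  assumes "dyadic_lattice \<D>"
  shows "countable \<D>" "Q \<in> \<D> \<Longrightarrow> Q \<in> sets borel" "Q \<in> \<D> \<Longrightarrow> bounded Q"
    "Q \<in> \<D> \<Longrightarrow> 0 < measure lborel Q"
proof -
  obtain G :: "int \<Rightarrow> (real ^ 'a) set set" where \<D>: "\<D> = (\<Union>k. G k)"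
    and part: "\<And>k. partition_on UNIV (G k)"
    and cube: "\<And>k Q. Q \<in> G k \<Longrightarrow> \<exists>x. Q = half_open_cube x (2 powi (- k))"
    using assms unfolding dyadic_lattice_def by metis
  have "countable (G k)" for k
  proof (rule countable_disjoint_nonempty_interior_subsets)
    show "pairwise disjnt (G k)" using part by (auto simp: partition_on_def)
  next
    fix Q assume "Q \<in> G k" "interior Q = {}"
    then show "Q = {}" using cube[of Q k] interior_half_open_cube_ne[of "2 powi (- k)"] by auto
  qed
  then show "countable \<D>" by (simp add: \<D>)
  assume "Q \<in> \<D>"
  then obtain k x where Q: "Q = half_open_cube x (2 powi (- k))" using \<D> cube by blast
  show "Q \<in> sets borel" "bounded Q" "0 < measure lborel Q"
    by (simp_all add: Q bounded_half_open_cube measure_half_open_cube)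
qed

text \<open>The cube \<open>K (k + 1)\<close> is one of the at least two pairwise disjoint nonempty children of
  \<open>K k\<close>, hence the inclusion is strict. There is no lower bound for \<open>k\<close>: the cubes of negative
  generation contain \<open>x\<close> as well and have to be taken into account in the \<open>A\<close>-condition.\<close>

lemma dyadic_lattice_chain:
  fixes \<D> :: "(real ^ 'n) set set" and x :: "real ^ 'n"
  assumes "dyadic_lattice \<D>"
  obtains K :: "int \<Rightarrow> (real ^ 'n) set" where "\<And>k. K k \<in> \<D>" "\<And>k. x \<in> K k" "\<And>k. K (k + 1) \<subset> K k"
    "\<And>k. measure lborel (K k) = (2 powi (- k)) ^ CARD('n)"
    "\<And>Q. Q \<in> \<D> \<Longrightarrow> x \<in> Q \<Longrightarrow> \<exists>k. Q = K k"
proof -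
  obtain G :: "int \<Rightarrow> (real ^ 'n) set set" where \<D>: "\<D> = (\<Union>k. G k)"
    and part: "\<And>k. partition_on UNIV (G k)"
    and cube: "\<And>k Q. Q \<in> G k \<Longrightarrow> \<exists>x. Q = half_open_cube x (2 powi (- k))"
    and children: "\<And>k Q. Q \<in> G k \<Longrightarrow> \<exists>C\<subseteq>G (k + 1). card C = 2 ^ CARD('n) \<and> Q = \<Union>C"
    using assms unfolding dyadic_lattice_def by metis
  have "\<exists>Q. Q \<in> G k \<and> x \<in> Q" for k
    using partition_onD1[OF part[of k]] by blast
  then obtain K where K: "\<And>k. K k \<in> G k" "\<And>k. x \<in> K k" by metis
  have uniq: "Q = K k" if "Q \<in> G k" "x \<in> Q" for Q k
    using partition_onD2[OF part[of k]] that K[of k] by (auto simp: disjoint_def)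
  show ?thesis
  proof (rule that)
    show "K k \<in> \<D>" "x \<in> K k" for k using K \<D> by auto
    show "measure lborel (K k) = (2 powi (- k)) ^ CARD('n)" for k
      using cube[OF K(1)[of k]] by (auto simp: measure_half_open_cube)
    show "\<exists>k. Q = K k" if "Q \<in> \<D>" "x \<in> Q" for Q
      using that uniq \<D> by blast
    show "K (k + 1) \<subset> K k" for k
    proof -
      obtain C where C: "C \<subseteq> G (k + 1)" "card C = 2 ^ CARD('n)" "K k = \<Union>C"
        using children[OF K(1)] by blast
      have in_C: "K (k + 1) \<in> C" using C K(2)[of k] uniq by blast
      have "C \<noteq> {K (k + 1)}" using C(2) one_less_power[of "2::nat" "CARD('n)"] by auto
      then obtain Q where Q: "Q \<in> C" "Q \<noteq> K (k + 1)" using in_C by blast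
      have "Q \<noteq> {}" using Q C(1) partition_onD3[OF part[of "k + 1"]] by auto
      moreover have "Q \<inter> K (k + 1) = {}"
        using partition_onD2[OF part[of "k + 1"]] Q C(1) K(1)[of "k + 1"] by (auto simp: disjoint_def)
      ultimately show ?thesis using in_C Q C(3) by blast
    qed
  qed
qed

section \<open>Atomic measures along a chain of cubes\<close>

lemma finite_measure_radon:
  fixes M :: "'a :: {second_countable_topology, complete_space} measure"
  assumes sets: "sets M = sets borel" and "finite_measure M"
  shows "radon_measure M"
  unfolding radon_measure_def
proof (intro conjI allI impI ballI)
  interpret finite_measure M by fact
  show "emeasure M K < \<infinity>" for K
    by (simp add: less_top[symmetric])
  show "emeasure M B = (SUP K\<in>{K. K \<subseteq> B \<and> compact K}. emeasure M K)" if "B \<in> sets borel" for B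
    using sets that by (intro inner_regular) auto
qed (fact sets)

lemma infsum_nat_ennreal:
  fixes f :: "nat \<Rightarrow> ennreal"
  shows "infsum f UNIV = (\<Sum>n. f n)"
proof -
  have "f sums infsum f UNIV"
    by (intro has_sum_imp_sums has_sum_infsum nonneg_summable_on_complete) simp
  then show ?thesis by (rule sums_unique)
qed

lemma infsum_ennreal_range:
  fixes h :: "'i \<Rightarrow> ennreal" and L :: "nat \<Rightarrow> 'i"
  assumes "inj L" and "range L \<subseteq> I" and "\<And>i. i \<in> I \<Longrightarrow> i \<notin> range L \<Longrightarrow> h i = 0"
  shows "infsum h I = (\<Sum>n. h (L n))"
proof -
  have "infsum h I = infsum h (range L)"
    using assms(2,3) by (intro infsum_cong_neutral) auto
  also have "\<dots> = (\<Sum>n. h (L n))"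
    using assms(1) by (simp add: infsum_reindex infsum_nat_ennreal comp_def)
  finally show ?thesis .
qed

lemma suminf_powr_less_top_iff: "(\<Sum>n. ennreal (real (Suc n) powr t)) < top \<longleftrightarrow> t < -1"
proof -
  have "summable (\<lambda>n. real (Suc n) powr t) \<longleftrightarrow> t < -1"
    using summable_real_powr_iff[of t] summable_Suc_iff[of "\<lambda>n. real n powr t"] by simp
  moreover have "(\<Sum>n. ennreal (real (Suc n) powr t)) \<noteq> top \<longleftrightarrow> summable (\<lambda>n. real (Suc n) powr t)"
    using summable_suminf_not_top[OF powr_ge_zero] ennreal_suminf_neq_top[OF _ powr_ge_zero]
    by (rule iffI)
  ultimately show ?thesis
    by (simp only: less_top)
qed

lemma borel_measurable_square_function:
  assumes "countable \<D>" and "\<And>Q. Q \<in> \<D> \<Longrightarrow> Q \<in> sets borel"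
    and "\<And>Q. Q \<in> \<D> \<Longrightarrow> g Q \<in> borel_measurable borel"
  shows "square_function \<D> g \<in> borel_measurable borel"
proof -
  have "(\<lambda>x. \<Sum>\<^sub>\<infinity>Q\<in>\<D>. ennreal ((g Q x)\<^sup>2) * indicator Q x) \<in> borel_measurable borel"
  proof (rule borel_measurable_infsum_ennreal[OF assms(1)])
    fix Q assume "Q \<in> \<D>"
    then have [measurable]: "Q \<in> sets borel" "g Q \<in> borel_measurable borel" using assms by auto
    show "(\<lambda>x. ennreal ((g Q x)\<^sup>2) * indicator Q x) \<in> borel_measurable borel" by measurable
  qed
  then show ?thesis
    unfolding square_function_def by measurable
qed

text \<open>The mass at \<open>y n\<close> is a geometric sequence with ratio \<open>\<rho> < 1\<close>, and the atoms in \<open>L n\<close>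
  are those of index at least \<open>n\<close>. Their total mass is therefore a fixed multiple \<open>C\<close> of the mass
  at \<open>y n\<close>. The cubes of negative generation contain all atoms, but they have volume at least \<open>1\<close>,
  so that the total mass \<open>C\<close> suffices for them.\<close>

lemma chain_atomic_measure:
  fixes \<D> :: "(real ^ 'n) set set" and x :: "real ^ 'n" and s :: real
  assumes "dyadic_lattice \<D>" and "0 < s"
  obtains L :: "nat \<Rightarrow> (real ^ 'n) set" and y :: "nat \<Rightarrow> real ^ 'n" and \<mu> and C :: real
  where "inj L" "\<And>n. L n \<in> \<D>" "\<And>n. x \<in> L n" "inj y" "\<And>n. y n \<in> L n"
    "sets \<mu> = sets borel" "finite_measure \<mu>" "radon_measure \<mu>"
    "\<And>g. g \<in> borel_measurable borel \<Longrightarrow>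
      (\<integral>\<^sup>+z. g z \<partial>\<mu>) = (\<Sum>n. ennreal (measure lborel (L n) powr s) * g (y n))"
    "0 \<le> C"
    "\<And>Q. Q \<in> \<D> \<Longrightarrow> x \<in> Q \<Longrightarrow> emeasure \<mu> Q \<le> ennreal (C * measure lborel Q powr s)"
proof -
  obtain K :: "int \<Rightarrow> (real ^ 'n) set" where K: "\<And>k. K k \<in> \<D>" "\<And>k. x \<in> K k"
    and K_step: "\<And>k. K (k + 1) \<subset> K k"
    and K_measure: "\<And>k. measure lborel (K k) = (2 powi (- k)) ^ CARD('n)"
    and K_all: "\<And>Q. Q \<in> \<D> \<Longrightarrow> x \<in> Q \<Longrightarrow> \<exists>k. Q = K k"
    using dyadic_lattice_chain[OF assms(1), of x] by metis
  define L where "L n = K (int n)" for n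
  have L_step: "L (Suc n) \<subset> L n" for n
    using K_step[of "int n"] by (simp add: L_def add.commute)
  have L_anti: "L n \<subseteq> L m" if "m \<le> n" for m n
    by (rule lift_Suc_antimono_le[of L, OF psubset_imp_subset[OF L_step] that])
  have "\<exists>z. z \<in> L n \<and> z \<notin> L (Suc n)" for n using L_step[of n] by blast
  then obtain y where y: "\<And>n. y n \<in> L n" "\<And>n. y n \<notin> L (Suc n)" by metis
  have y_in: "n \<le> j" if "y j \<in> L n" for j n
  proof (rule ccontr)
    assume "\<not> n \<le> j"
    then have "L n \<subseteq> L (Suc j)" by (intro L_anti) auto
    then show False using that y(2) by blast
  qed
  have "inj y"
  proof (rule injI)
    fix i j assume "y i = y j"
    then show "i = j" using y_in[of i j] y_in[of j i] y(1)[of i] y(1)[of j] by auto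
  qed
  have "inj L"
  proof (rule injI)
    fix i j assume eq: "L i = L j"
    have "j \<le> i" using y_in[of i j] y(1)[of i] unfolding eq .
    moreover have "i \<le> j" using y_in[of j i] y(1)[of j] unfolding eq .
    ultimately show "i = j" by simp
  qed
  \<comment> \<open>the \<open>s\<close>-th power of the ratio of the volumes of a cube and its parent\<close>
  define \<rho> where "\<rho> = (1 / 2 ^ CARD('n)) powr s"
  have \<rho>: "0 < \<rho>" "\<rho> < 1"
    using assms(2) powr_less_mono2[of s "1 / 2 ^ CARD('n)" 1] by (auto simp: \<rho>_def)
  have mass: "measure lborel (L n) powr s = \<rho> ^ n" for n
  proof -
    have "measure lborel (L n) = (1 / 2 ^ n) ^ CARD('n)"
      by (simp add: L_def K_measure power_int_minus inverse_eq_divide)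
    also have "\<dots> = (1 / 2 ^ CARD('n)) ^ n"
      unfolding power_one_over by (simp only: power_mult[symmetric] mult.commute)
    also have "\<dots> = (1 / 2 ^ CARD('n)) powr real n"
      by (rule powr_realpow[symmetric]) simp
    also have "\<dots> powr s = \<rho> powr real n"
      unfolding \<rho>_def powr_powr by (simp only: mult.commute)
    also have "\<dots> = \<rho> ^ n"
      using \<rho>(1) by (rule powr_realpow)
    finally show ?thesis .
  qed
  define \<mu> where "\<mu> = distr (density (count_space UNIV) (\<lambda>n. ennreal (\<rho> ^ n))) borel y"
  have sets_\<mu>: "sets \<mu> = sets borel" by (simp add: \<mu>_def)
  have integral_\<mu>: "(\<integral>\<^sup>+z. g z \<partial>\<mu>) = (\<Sum>n. ennreal (\<rho> ^ n) * g (y n))"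
    if [measurable]: "g \<in> borel_measurable borel" for g
    unfolding \<mu>_def
    by (subst nn_integral_distr) (auto simp: nn_integral_density nn_integral_count_space_nat)
  define C where "C = 1 / (1 - \<rho>)"
  have "0 \<le> C" using \<rho> by (simp add: C_def)
  have emeasure_\<mu>: "emeasure \<mu> B \<le> ennreal (C * \<rho> ^ n)"
    if B: "B \<in> sets borel" and tail: "\<And>j. y j \<in> B \<Longrightarrow> n \<le> j" for B n
  proof -
    define h where "h j = (if n \<le> j then \<rho> ^ j else 0)" for j
    have h_nonneg: "0 \<le> h j" for j using \<rho> by (simp add: h_def)
    have "(\<lambda>i. \<rho> ^ n * \<rho> ^ i) sums (\<rho> ^ n * (1 / (1 - \<rho>)))"
      using \<rho> by (intro sums_mult geometric_sums) auto
    then have "(\<lambda>i. h (i + n)) sums (C * \<rho> ^ n)"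
      by (simp add: h_def C_def power_add mult.commute)
    then have "h sums (C * \<rho> ^ n)"
      by (subst (asm) sums_zero_iff_shift) (auto simp: h_def)
    then have "(\<Sum>j. ennreal (h j)) = ennreal (C * \<rho> ^ n)"
      by (rule suminf_ennreal_eq[OF h_nonneg])
    moreover have "emeasure \<mu> B = (\<Sum>j. ennreal (\<rho> ^ j) * indicator B (y j))"
      using integral_\<mu>[of "indicator B"] B sets_\<mu> by simp
    moreover have "\<dots> \<le> (\<Sum>j. ennreal (h j))"
    proof (rule suminf_le)
      fix j
      show "ennreal (\<rho> ^ j) * indicator B (y j) \<le> ennreal (h j)"
        using tail[of j] by (cases "y j \<in> B") (simp_all add: h_def)
    qed simp_all
    ultimately show ?thesis by simp
  qed
  have total: "emeasure \<mu> B \<le> ennreal C" if "B \<in> sets borel" for B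
    using emeasure_\<mu>[OF that, of 0] by simp
  have fin: "emeasure \<mu> (space \<mu>) < \<infinity>"
  proof -
    have "emeasure \<mu> (space \<mu>) \<le> ennreal C"
      using sets.top[of \<mu>] sets_\<mu> by (intro total) simp
    then show ?thesis by (rule le_less_trans) simp
  qed
  show ?thesis
  proof (rule that[of L y \<mu> C])
    show "emeasure \<mu> Q \<le> ennreal (C * measure lborel Q powr s)" if Q: "Q \<in> \<D>" "x \<in> Q" for Q
    proof -
      obtain k where k: "Q = K k" using K_all[OF Q] by blast
      have Q_borel: "Q \<in> sets borel" using dyadic_lattice_cubes(2)[OF assms(1) Q(1)] .
      show ?thesis
      proof (cases "0 \<le> k")
        case True
        then obtain n where "k = int n" using nonneg_int_cases by blast
        then have "Q = L n" by (simp add: k L_def)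
        then show ?thesis using emeasure_\<mu>[OF Q_borel, of n] y_in by (simp add: mass)
      next
        case False
        then have "1 \<le> (2::real) powi (- k)" by (intro one_le_power_int) auto
        then have "1 \<le> measure lborel Q powr s"
          unfolding k K_measure using assms(2) by (intro ge_one_powr_ge_zero one_le_power) auto
        then have "ennreal C \<le> ennreal (C * measure lborel Q powr s)"
          using mult_left_mono[of 1 "measure lborel Q powr s" C] \<open>0 \<le> C\<close> by (intro ennreal_leI) simp
        with total[OF Q_borel] show ?thesis by (rule order_trans)
      qed
    qed
    show "finite_measure \<mu>" using fin by (intro finite_measureI) auto
    then show "radon_measure \<mu>" using sets_\<mu> by (intro finite_measure_radon)
    show "(\<integral>\<^sup>+z. g z \<partial>\<mu>) = (\<Sum>n. ennreal (measure lborel (L n) powr s) * g (y n))"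
      if "g \<in> borel_measurable borel" for g
      by (simp add: mass integral_\<mu>[OF that])
    show "L n \<in> \<D>" "x \<in> L n" for n by (simp_all add: L_def K)
    show "inj L" "inj y" "sets \<mu> = sets borel" "0 \<le> C" by fact+
    show "y n \<in> L n" for n by (rule y(1))
  qed
qed

section \<open>Necessity\<close>

lemma locally_integrable_of_integrable:
  assumes "sets M = sets (borel :: 'a :: t2_space measure)" and "integrable M f"
  shows "locally_integrable M f"
  using assms integrable_mult_indicator[OF _ assms(2)]
  by (auto simp: locally_integrable_def set_integrable_def compact_imp_closed)

text \<open>A point mass contributes the factor \<open>1\<close> to the \<open>A\<close>-quotient of the cubes containing the
  point, and what remains of the quotient is estimated here.\<close>

lemma dyadic_powr_quotient_le:
  assumes "dyadic_lattice \<D>" and "Q \<in> \<D>" and "0 < s" and "0 \<le> C"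
    and "emeasure \<mu> Q \<le> ennreal (C * measure lborel Q powr s)"
  shows "ennreal_powr (emeasure \<mu> Q) (1 / s) / emeasure lborel Q \<le> ennreal (C powr (1 / s))"
proof -
  have pos: "0 < measure lborel Q"
    using dyadic_lattice_cubes(4)[OF assms(1,2)] .
  have vol: "emeasure lborel Q = ennreal (measure lborel Q)"
    using emeasure_bounded_finite[OF dyadic_lattice_cubes(3)[OF assms(1,2)]]
    by (intro emeasure_eq_ennreal_measure) auto
  have "ennreal_powr (emeasure \<mu> Q) (1 / s) \<le> ennreal_powr (ennreal (C * measure lborel Q powr s)) (1 / s)"
    using assms(3,5) by (intro ennreal_powr_mono) auto
  also have "\<dots> = ennreal (C powr (1 / s) * measure lborel Q)"
    using assms(3,4) pos by (simp add: powr_mult powr_powr)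
  finally have "ennreal_powr (emeasure \<mu> Q) (1 / s) / emeasure lborel Q
      \<le> ennreal (C powr (1 / s) * measure lborel Q) / ennreal (measure lborel Q)"
    unfolding vol by (rule divide_right_mono_ennreal)
  also have "\<dots> = ennreal (C powr (1 / s))"
    using pos by (simp add: divide_ennreal)
  finally show ?thesis .
qed

text \<open>Here \<open>\<sigma> = \<mu>\<close> with \<open>s = p'\<close> and \<open>w\<close> is the point mass \<open>\<delta>\<close>. The function \<open>f (L n)\<close> is \<open>a n\<close>
  times the indicator of \<open>y n\<close>. The powers of the volume in \<open>a n\<close> are chosen such that the
  average over \<open>L n\<close> is \<open>(n + 1) powr (-1/2)\<close>, while the \<open>p\<close>-th power of the right-hand norm is the
  sum of the \<open>(n + 1) powr (-p/2)\<close>; the two volume exponents vanish together because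
  \<open>s * (p - 1) = p\<close>.\<close>

lemma Stein_counterexample_p_gt_2:
  fixes \<D> :: "(real ^ 'n) set set" and p q :: real
  assumes dyadic: "dyadic_lattice \<D>" and p: "2 < p"
  obtains \<sigma> w :: "(real ^ 'n) measure" and f :: "(real ^ 'n) set \<Rightarrow> real ^ 'n \<Rightarrow> real"
  where "radon_measure \<sigma>" "radon_measure w" "simple_A \<D> p q \<sigma> w < \<infinity>"
    "\<And>Q. locally_integrable \<sigma> (f Q)"
    "Lp_norm q w (square_function \<D> (\<lambda>Q x. (LINT y:Q|\<sigma>. f Q y) / measure lborel Q)) = \<infinity>"
    "Lp_norm p \<sigma> (square_function \<D> f) < \<infinity>"
proof -
  define s where "s = hoelder_conjugate p"
  have s: "0 < s" "s * (p - 1) = p" using p by (auto simp: s_def hoelder_conjugate_def)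
  define x :: "real ^ 'n" where "x = 0"
  obtain L y \<mu> C where L: "inj L" "\<And>n. L n \<in> \<D>" "\<And>n. x \<in> L n"
    and y: "inj y" "\<And>n. y n \<in> L n"
    and \<mu>: "sets \<mu> = sets borel" "finite_measure \<mu>" "radon_measure \<mu>"
    and integral_\<mu>: "\<And>g. g \<in> borel_measurable borel \<Longrightarrow>
      (\<integral>\<^sup>+z. g z \<partial>\<mu>) = (\<Sum>n. ennreal (measure lborel (L n) powr s) * g (y n))"
    and C: "0 \<le> C"
    and \<mu>_le: "\<And>Q. Q \<in> \<D> \<Longrightarrow> x \<in> Q \<Longrightarrow> emeasure \<mu> Q \<le> ennreal (C * measure lborel Q powr s)"
    by (rule chain_atomic_measure[OF dyadic s(1), of x]) (rule that)
  define V where "V n = measure lborel (L n)" for n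
  have V: "0 < V n" for n using dyadic_lattice_cubes(4)[OF dyadic L(2)] by (simp add: V_def)
  define \<delta> where "\<delta> = return borel x"
  define a where "a n = V n powr (1 - s) * real (Suc n) powr (- 1 / 2)" for n
  \<comment> \<open>The functions are indexed by cubes, so the position of a cube in the chain is recovered by
    \<open>inv L\<close>.\<close>
  define f where "f Q z = (if Q \<in> range L then a (inv L Q) * indicator {y (inv L Q)} z else 0)" for Q z
  define c where "c Q = (LINT z:Q|\<mu>. f Q z) / measure lborel Q" for Q
  have f_L: "f (L n) z = a n * indicator {y n} z" for n z
    using L(1) by (simp add: f_def)
  have f_int: "integrable \<mu> (f Q)" for Q
  proof -
    have "integrable \<mu> (indicator {z} :: _ \<Rightarrow> real)" for z
      using \<mu>(1) finite_measure.emeasure_finite[OF \<mu>(2), of "{z}"]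
      by (intro integrable_real_indicator) (auto simp: less_top[symmetric])
    then show ?thesis
      by (cases "Q \<in> range L") (simp_all add: f_def[abs_def])
  qed
  have f_meas: "f Q \<in> borel_measurable borel" for Q
    using borel_measurable_integrable[OF f_int] \<mu>(1) by (simp cong: measurable_cong_sets)
  have atom: "measure \<mu> {y n} = V n powr s" for n
  proof -
    have "emeasure \<mu> {y n} = (\<Sum>j. ennreal (V j powr s) * indicator {y n} (y j))"
      using integral_\<mu>[of "indicator {y n}"] \<mu>(1) by (simp add: V_def)
    also have "(\<lambda>j. ennreal (V j powr s) * indicator {y n} (y j)) = (\<lambda>j. if j = n then ennreal (V j powr s) else 0)"
      using y(1) by (auto simp: fun_eq_iff inj_eq)
    also have "(\<Sum>j. if j = n then ennreal (V j powr s) else 0) = ennreal (V n powr s)"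
      using sums_single[of n "\<lambda>j. ennreal (V j powr s)"] by (simp add: sums_iff)
    finally show ?thesis by (simp add: measure_def)
  qed
  have c_L: "c (L n) = real (Suc n) powr (- 1 / 2)" for n
  proof -
    have "(LINT z:L n|\<mu>. f (L n) z) = (LINT z|\<mu>. a n * indicator {y n} z)"
      unfolding set_lebesgue_integral_def using y(2)
      by (intro Bochner_Integration.integral_cong) (auto simp: f_L split: split_indicator)
    also have "\<dots> = a n * V n powr s"
      using \<mu>(1) sets_eq_imp_space_eq[OF \<mu>(1)] by (simp add: atom)
    finally have "c (L n) = V n powr (1 - s) * V n powr s / V n * real (Suc n) powr (- 1 / 2)"
      by (simp add: c_def V_def[symmetric] a_def)
    then show ?thesis using V[of n] by (simp flip: powr_add)
  qed
  have c_0: "c Q = 0" if "Q \<notin> range L" for Q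
    using that by (simp add: c_def f_def set_lebesgue_integral_def)
  have sq_c: "square_function \<D> (\<lambda>Q z. c Q) x = \<infinity>"
  proof -
    have "(\<Sum>\<^sub>\<infinity>Q\<in>\<D>. ennreal ((c Q)\<^sup>2) * indicator Q x) = (\<Sum>n. ennreal ((c (L n))\<^sup>2) * indicator (L n) x)"
      using L c_0 by (intro infsum_ennreal_range) auto
    also have "\<dots> = (\<Sum>n. ennreal (real (Suc n) powr (-1)))"
      using L(3) by (simp add: c_L powr_power del: of_nat_Suc)
    also have "\<dots> = top"
      using suminf_powr_less_top_iff[of "-1"] by (simp add: less_top[symmetric] del: of_nat_Suc)
    finally show ?thesis by (simp add: square_function_def)
  qed
  have sq_f: "square_function \<D> f (y j) = ennreal (a j)" for j
  proof -
    have "(\<Sum>\<^sub>\<infinity>Q\<in>\<D>. ennreal ((f Q (y j))\<^sup>2) * indicator Q (y j))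
        = (\<Sum>n. ennreal ((f (L n) (y j))\<^sup>2) * indicator (L n) (y j))"
      using L by (intro infsum_ennreal_range) (auto simp: f_def)
    also have "(\<lambda>n. ennreal ((f (L n) (y j))\<^sup>2) * indicator (L n) (y j))
        = (\<lambda>n. if n = j then ennreal ((a n)\<^sup>2) else 0)"
      using y by (auto simp: fun_eq_iff f_L inj_eq)
    also have "(\<Sum>n. if n = j then ennreal ((a n)\<^sup>2) else 0) = ennreal ((a j)\<^sup>2)"
      using sums_single[of j "\<lambda>n. ennreal ((a n)\<^sup>2)"] by (simp add: sums_iff)
    finally show ?thesis
      by (simp add: square_function_def a_def powr_half_sqrt)
  qed
  show ?thesis
  proof (rule that[of \<mu> \<delta> f])
    show "radon_measure \<mu>" by fact
    show "radon_measure \<delta>"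
      unfolding \<delta>_def by (intro finite_measure_radon prob_space.finite_measure prob_space_return) auto
    have "simple_A \<D> p q \<mu> \<delta> \<le> ennreal (C powr (1 / s))"
      unfolding simple_A_def s_def[symmetric]
    proof (rule SUP_least)
      fix Q assume Q: "Q \<in> \<D>"
      then have [measurable]: "Q \<in> sets borel" by (rule dyadic_lattice_cubes(2)[OF dyadic])
      show "ennreal_powr (emeasure \<mu> Q) (1 / s) * ennreal_powr (emeasure \<delta> Q) (1 / q) / emeasure lborel Q
          \<le> ennreal (C powr (1 / s))"
      proof (cases "x \<in> Q")
        case True
        then have "ennreal_powr (emeasure \<delta> Q) (1 / q) = 1"
          using ennreal_powr_ennreal[of 1 "1 / q"] by (simp add: \<delta>_def)
        then show ?thesis
          using dyadic_powr_quotient_le[OF dyadic Q s(1) C \<mu>_le[OF Q True]] by simp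
      qed (simp add: \<delta>_def)
    qed
    then show "simple_A \<D> p q \<mu> \<delta> < \<infinity>" by (rule le_less_trans) simp
    show "locally_integrable \<mu> (f Q)" for Q
      using \<mu>(1) f_int by (rule locally_integrable_of_integrable)
    have "square_function \<D> (\<lambda>Q z. c Q) \<in> borel_measurable borel"
      using dyadic_lattice_cubes[OF dyadic] by (intro borel_measurable_square_function) auto
    then have "(\<integral>\<^sup>+z. ennreal_powr (square_function \<D> (\<lambda>Q z. c Q) z) q \<partial>\<delta>) = top"
      unfolding \<delta>_def by (subst nn_integral_return) (auto simp: sq_c)
    then show "Lp_norm q \<delta> (square_function \<D> (\<lambda>Q x. (LINT y:Q|\<mu>. f Q y) / measure lborel Q)) = \<infinity>"
      by (simp add: Lp_norm_def c_def)
    have "square_function \<D> f \<in> borel_measurable borel"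
      using dyadic_lattice_cubes[OF dyadic] f_meas by (intro borel_measurable_square_function) auto
    then have "(\<integral>\<^sup>+z. ennreal_powr (square_function \<D> f z) p \<partial>\<mu>)
        = (\<Sum>j. ennreal (V j powr s) * ennreal_powr (square_function \<D> f (y j)) p)"
      by (subst integral_\<mu>) (auto simp: V_def)
    also have "\<dots> = (\<Sum>j. ennreal (real (Suc j) powr (- p / 2)))"
    proof (rule suminf_cong)
      fix j
      have "V j powr s * a j powr p = V j powr (s + (1 - s) * p) * real (Suc j) powr (- p / 2)"
        by (simp add: a_def powr_mult powr_powr powr_add del: of_nat_Suc)
      also have "s + (1 - s) * p = 0" using s(2) by (simp add: algebra_simps)
      finally have "V j powr s * a j powr p = real (Suc j) powr (- p / 2)"
        using V[of j] by simp
      then show "ennreal (V j powr s) * ennreal_powr (square_function \<D> f (y j)) p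
          = ennreal (real (Suc j) powr (- p / 2))"
        by (simp add: sq_f a_def del: of_nat_Suc flip: ennreal_mult)
    qed
    also have "\<dots> < top"
      using suminf_powr_less_top_iff[of "- p / 2"] p by simp
    finally show "Lp_norm p \<mu> (square_function \<D> f) < \<infinity>"
      by (simp add: Lp_norm_def ennreal_powr_def)
  qed
qed

text \<open>Here \<open>w = \<mu>\<close> with \<open>s = q\<close> and \<open>\<sigma>\<close> is the point mass \<open>\<delta>\<close>. The function \<open>f (L n)\<close> is the
  constant \<open>a n = (n + 1) powr (-1/q)\<close>; this sequence is square summable, but its \<open>q\<close>-th powers
  form the harmonic series. At the atom \<open>y j\<close> the single term of the cube \<open>L j\<close> already suffices
  to bound the left-hand square function from below.\<close>

lemma Stein_counterexample_q_lt_2: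
  fixes \<D> :: "(real ^ 'n) set set" and p q :: real
  assumes dyadic: "dyadic_lattice \<D>" and q: "0 < q" "q < 2"
  obtains \<sigma> w :: "(real ^ 'n) measure" and f :: "(real ^ 'n) set \<Rightarrow> real ^ 'n \<Rightarrow> real"
  where "radon_measure \<sigma>" "radon_measure w" "simple_A \<D> p q \<sigma> w < \<infinity>"
    "\<And>Q. locally_integrable \<sigma> (f Q)"
    "Lp_norm q w (square_function \<D> (\<lambda>Q x. (LINT y:Q|\<sigma>. f Q y) / measure lborel Q)) = \<infinity>"
    "Lp_norm p \<sigma> (square_function \<D> f) < \<infinity>"
proof -
  define x :: "real ^ 'n" where "x = 0"
  obtain L y \<mu> C where L: "inj L" "\<And>n. L n \<in> \<D>" "\<And>n. x \<in> L n"
    and y: "inj y" "\<And>n. y n \<in> L n"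
    and \<mu>: "sets \<mu> = sets borel" "finite_measure \<mu>" "radon_measure \<mu>"
    and integral_\<mu>: "\<And>g. g \<in> borel_measurable borel \<Longrightarrow>
      (\<integral>\<^sup>+z. g z \<partial>\<mu>) = (\<Sum>n. ennreal (measure lborel (L n) powr q) * g (y n))"
    and C: "0 \<le> C"
    and \<mu>_le: "\<And>Q. Q \<in> \<D> \<Longrightarrow> x \<in> Q \<Longrightarrow> emeasure \<mu> Q \<le> ennreal (C * measure lborel Q powr q)"
    by (rule chain_atomic_measure[OF dyadic q(1), of x]) (rule that)
  define V where "V n = measure lborel (L n)" for n
  have V: "0 < V n" for n using dyadic_lattice_cubes(4)[OF dyadic L(2)] by (simp add: V_def)
  define \<delta> where "\<delta> = return borel x"
  interpret \<delta>: prob_space \<delta> unfolding \<delta>_def by (intro prob_space_return) simp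
  have sets_\<delta>: "sets \<delta> = sets borel" by (simp add: \<delta>_def)
  define a where "a n = real (Suc n) powr (- 1 / q)" for n
  define f :: "(real ^ 'n) set \<Rightarrow> real ^ 'n \<Rightarrow> real"
    where "f Q z = (if Q \<in> range L then a (inv L Q) else 0)" for Q z
  define c where "c Q = (LINT z:Q|\<delta>. f Q z) / measure lborel Q" for Q
  have f_L: "f (L n) z = a n" for n z using L(1) by (simp add: f_def)
  have c_L: "c (L n) = a n / V n" for n
  proof -
    have [measurable]: "L n \<in> sets borel" using dyadic_lattice_cubes(2)[OF dyadic L(2)] .
    have "(LINT z:L n|\<delta>. f (L n) z) = a n"
      unfolding set_lebesgue_integral_def \<delta>_def using L(3)
      by (subst integral_return) (auto simp: f_L)
    then show ?thesis by (simp add: c_def V_def)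
  qed
  have sq_f: "square_function \<D> f x < top"
  proof -
    have "(\<Sum>\<^sub>\<infinity>Q\<in>\<D>. ennreal ((f Q x)\<^sup>2) * indicator Q x) = (\<Sum>n. ennreal ((f (L n) x)\<^sup>2) * indicator (L n) x)"
      using L by (intro infsum_ennreal_range) (auto simp: f_def)
    also have "\<dots> = (\<Sum>n. ennreal (real (Suc n) powr (- 2 / q)))"
      using L(3) by (simp add: f_L a_def powr_power del: of_nat_Suc)
    also have "\<dots> < top"
      using q by (subst suminf_powr_less_top_iff) simp
    finally show ?thesis by (simp add: square_function_def ennreal_powr_def)
  qed
  have sq_c: "ennreal (a j / V j) \<le> square_function \<D> (\<lambda>Q z. c Q) (y j)" for j
  proof -
    have "ennreal ((c (L j))\<^sup>2) \<le> (\<Sum>\<^sub>\<infinity>Q\<in>\<D>. ennreal ((c Q)\<^sup>2) * indicator Q (y j))"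
      using sum_le_infsum_ennreal[of "{L j}" \<D> "\<lambda>Q. ennreal ((c Q)\<^sup>2) * indicator Q (y j)"] L(2) y(2)
      by simp
    then have "ennreal_powr (ennreal ((c (L j))\<^sup>2)) (1 / 2) \<le> square_function \<D> (\<lambda>Q z. c Q) (y j)"
      unfolding square_function_def by (intro ennreal_powr_mono) auto
    then show ?thesis
      using V[of j] by (simp add: c_L a_def powr_half_sqrt)
  qed
  show ?thesis
  proof (rule that[of \<delta> \<mu> f])
    show "radon_measure \<mu>" by fact
    show "radon_measure \<delta>"
      using sets_\<delta> \<delta>.finite_measure_axioms by (rule finite_measure_radon)
    have "simple_A \<D> p q \<delta> \<mu> \<le> ennreal (C powr (1 / q))"
      unfolding simple_A_def
    proof (rule SUP_least)
      fix Q assume Q: "Q \<in> \<D>"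
      then have [measurable]: "Q \<in> sets borel" by (rule dyadic_lattice_cubes(2)[OF dyadic])
      show "ennreal_powr (emeasure \<delta> Q) (1 / hoelder_conjugate p) * ennreal_powr (emeasure \<mu> Q) (1 / q)
          / emeasure lborel Q \<le> ennreal (C powr (1 / q))"
      proof (cases "x \<in> Q")
        case True
        then have "ennreal_powr (emeasure \<delta> Q) (1 / hoelder_conjugate p) = 1"
          using ennreal_powr_ennreal[of 1 "1 / hoelder_conjugate p"] by (simp add: \<delta>_def)
        then show ?thesis
          using dyadic_powr_quotient_le[OF dyadic Q q(1) C \<mu>_le[OF Q True]] by simp
      qed (simp add: \<delta>_def)
    qed
    then show "simple_A \<D> p q \<delta> \<mu> < \<infinity>" by (rule le_less_trans) simp
    show "locally_integrable \<delta> (f Q)" for Q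
      using sets_\<delta> by (rule locally_integrable_of_integrable) (simp add: f_def[abs_def])
    have [measurable]: "square_function \<D> (\<lambda>Q z. c Q) \<in> borel_measurable borel"
      using dyadic_lattice_cubes[OF dyadic] by (intro borel_measurable_square_function) auto
    have "top = (\<Sum>j. ennreal (real (Suc j) powr (-1)))"
      using suminf_powr_less_top_iff[of "-1"] by (simp add: less_top[symmetric] del: of_nat_Suc)
    also have "\<dots> = (\<Sum>j. ennreal (V j powr q) * ennreal_powr (ennreal (a j / V j)) q)"
    proof (rule suminf_cong)
      fix j
      have "V j powr q * (a j / V j) powr q = real (Suc j) powr (-1)"
        using V[of j] q by (simp add: a_def powr_divide powr_powr del: of_nat_Suc)
      then show "ennreal (real (Suc j) powr (-1)) = ennreal (V j powr q) * ennreal_powr (ennreal (a j / V j)) q"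
        using V[of j] by (simp add: a_def del: of_nat_Suc flip: ennreal_mult)
    qed
    also have "\<dots> \<le> (\<Sum>j. ennreal (V j powr q) * ennreal_powr (square_function \<D> (\<lambda>Q z. c Q) (y j)) q)"
      using q sq_c by (intro suminf_le mult_left_mono ennreal_powr_mono) auto
    also have "\<dots> = (\<integral>\<^sup>+z. ennreal_powr (square_function \<D> (\<lambda>Q z. c Q) z) q \<partial>\<mu>)"
      by (subst integral_\<mu>) (auto simp: V_def)
    finally show "Lp_norm q \<mu> (square_function \<D> (\<lambda>Q x. (LINT y:Q|\<delta>. f Q y) / measure lborel Q)) = \<infinity>"
      by (simp add: Lp_norm_def c_def top_unique)
    have "square_function \<D> f \<in> borel_measurable borel"
      using dyadic_lattice_cubes[OF dyadic]
      by (intro borel_measurable_square_function) (auto simp: f_def[abs_def])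
    then have "(\<integral>\<^sup>+z. ennreal_powr (square_function \<D> f z) p \<partial>\<delta>) = ennreal_powr (square_function \<D> f x) p"
      unfolding \<delta>_def by (subst nn_integral_return) auto
    then show "Lp_norm p \<delta> (square_function \<D> f) < \<infinity>"
      using sq_f by (simp add: Lp_norm_def ennreal_powr_def)
  qed
qed

theorem corollary6p2:
  fixes \<D> :: "(real ^ 'n) set set" and p q :: real
  assumes "dyadic_lattice \<D>" and "1 < p" and "1 < q"
  shows "(\<forall>\<sigma> w :: (real ^ 'n) measure.
            radon_measure \<sigma> \<and> radon_measure w \<and> simple_A \<D> p q \<sigma> w < \<infinity> \<longrightarrow>
            (\<exists>S :: real. 0 \<le> S \<and>
              (\<forall>f :: (real ^ 'n) set \<Rightarrow> real ^ 'n \<Rightarrow> real.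
                (\<forall>Q\<in>\<D>. locally_integrable \<sigma> (f Q)) \<longrightarrow>
                Lp_norm q w (square_function \<D> (\<lambda>Q x. (LINT y:Q|\<sigma>. f Q y) / measure lborel Q))
                  \<le> ennreal S * Lp_norm p \<sigma> (square_function \<D> f))))
         \<longleftrightarrow> 1 < p \<and> p \<le> 2 \<and> 2 \<le> q"
    (is "?Stein \<longleftrightarrow> ?range")
proof
  assume ?range
  show ?Stein
  proof (intro allI impI)
    fix \<sigma> w :: "(real ^ 'n) measure"
    assume "radon_measure \<sigma> \<and> radon_measure w \<and> simple_A \<D> p q \<sigma> w < \<infinity>"
    then have \<sigma>: "sets \<sigma> = sets borel" and w: "sets w = sets borel"
      and fin: "ennreal (enn2real (simple_A \<D> p q \<sigma> w)) = simple_A \<D> p q \<sigma> w"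
      by (auto simp: radon_measure_def)
    show "\<exists>S :: real. 0 \<le> S \<and>
              (\<forall>f :: (real ^ 'n) set \<Rightarrow> real ^ 'n \<Rightarrow> real.
                (\<forall>Q\<in>\<D>. locally_integrable \<sigma> (f Q)) \<longrightarrow>
                Lp_norm q w (square_function \<D> (\<lambda>Q x. (LINT y:Q|\<sigma>. f Q y) / measure lborel Q))
                  \<le> ennreal S * Lp_norm p \<sigma> (square_function \<D> f))"
      using averages_square_function_le[OF dyadic_lattice_cubes[OF assms(1)] \<sigma> w] \<open>?range\<close>
      by (intro exI[of _ "enn2real (simple_A \<D> p q \<sigma> w)"]) (auto simp: fin)
  qed
next
  assume Stein: ?Stein
  have no_counterexample: False
    if counterexample: "radon_measure \<sigma>" "radon_measure w" "simple_A \<D> p q \<sigma> w < \<infinity>"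
      "\<And>Q. locally_integrable \<sigma> (f Q)"
      "Lp_norm q w (square_function \<D> (\<lambda>Q x. (LINT y:Q|\<sigma>. f Q y) / measure lborel Q)) = \<infinity>"
      "Lp_norm p \<sigma> (square_function \<D> f) < \<infinity>"
    for \<sigma> w :: "(real ^ 'n) measure" and f :: "(real ^ 'n) set \<Rightarrow> real ^ 'n \<Rightarrow> real"
  proof -
    obtain S where "Lp_norm q w (square_function \<D> (\<lambda>Q x. (LINT y:Q|\<sigma>. f Q y) / measure lborel Q))
        \<le> ennreal S * Lp_norm p \<sigma> (square_function \<D> f)"
      using Stein counterexample(1-4) by blast
    then show False
      using counterexample(5,6) by (auto simp: top_unique ennreal_mult_eq_top_iff)
  qed
  have "\<not> 2 < p"
  proof
    assume "2 < p"
    show False by (rule Stein_counterexample_p_gt_2[OF assms(1) \<open>2 < p\<close>]) (rule no_counterexample)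
  qed
  moreover have "\<not> q < 2"
  proof
    assume "q < 2"
    have "0 < q" using assms(3) by simp
    show False
      by (rule Stein_counterexample_q_lt_2[OF assms(1) \<open>0 < q\<close> \<open>q < 2\<close>]) (rule no_counterexample)
  qed
  ultimately show ?range using assms(2) by simp
qed

end
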